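(* Let $n$ be a positive even integer and $p=\frac{n-2}2$. Then for all angle structures $\alpha=(a_1,\dots,c_W)\in\mathcal A_{X_n}$ and all $\hbar>0$ (of the form $\hbar=(\mathsf b+\mathsf b^{-1})^{-2}$ with $\mathsf b>0$), one has $$|\mathcal Z_\hbar(X_n,\alpha)|=\left|\int_{\mathbb R+i\frac{\mu_{X_n}(\alpha)}{2\pi\sqrt\hbar}}J_{X_n}(\hbar,x)\,e^{\frac1{2\sqrt\hbar}x\lambda_{X_n}(\alpha)}\,dx\right|,$$ with $\mu_{X_n}(\alpha)=a_U-a_V$, $\lambda_{X_n}(\alpha)=2(a_V-a_U+a_W-b_V)$ and $$J_{X_n}(\hbar,x)=\int_{\mathcal Y'}d\mathbf y'\;e^{2i\pi\,\mathbf y'^\top Q_n\mathbf y'}\,e^{2i\pi x(y'_U-y'_W-x)}\,e^{\frac1{\sqrt\hbar}\left(\mathbf y'^\top\mathcal W_n-\pi x\right)}\,\frac{\Phi_{\mathsf b}(x-y'_U)\,\Phi_{\mathsf b}(y'_W)}{\Phi_{\mathsf b}(y'_1)\cdots\Phi_{\mathsf b}(y'_p)\,\Phi_{\mathsf b}(y'_U)},$$ where $\mathbf y'=(y'_1,\dots,y'_p,y'_U,y'_W)^\top$, $$\mathcal Y'=\mathcal Y'_{\hbar,\alpha}=\prod_{k=1,\dots,p,U}\Big(\mathbb R-\tfrac{i}{2\pi\sqrt\hbar}(\pi-a_k)\Big)\times\Big(\mathbb R+\tfrac{i}{2\pi\sqrt\hbar}(\pi-a_W)\Big),$$ $\mathcal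 W_n$ is the vector with entries $-2\pi\big(kp-\frac{k(k-1)}2\big)$ for $k=1,\dots,p$, then $-(p^2+p+3)\pi$ (index $U$) and $\pi$ (index $W$), and $Q_n$ is the symmetric matrix indexed by $1,\dots,p,U,W$ with $(Q_n)_{jk}=\min(j,k)$ and $(Q_n)_{jU}=j$ for $1\le j,k\le p$, $(Q_n)_{UU}=p+1$, $(Q_n)_{UW}=-\frac12$, and all entries $(Q_n)_{jW}$ ($1\le j\le p$) and $(Q_n)_{WW}$ equal to $0$.
   Context: Triangulations: a tetrahedron $T$ has totally ordered vertices $0,1,2,3$ and a sign $\varepsilon(T)=\pm1$ (recording whether the vertex order agrees with the orientation); $x_k(T)$ is its face opposite to vertex $k$. A triangulation $X$ consists of finitely many tetrahedra whose faces are all glued in pairs by the unique affine isomorphisms preserving vertex order; faces with the same name are glued. $X^k$ is the set of $k$-cells after gluing. $X_n$ ($n\geq2$ even, $p=\frac{n-2}2$), an ideal triangulation of the complement of the twist knot $K_n$ with $n$ half-twists, has tetrahedra $T_1,\dots,T_p,U,V,W$ and faces $e_1,\dots,e_{p+1},f_1,\dots,f_p,v,r,s,g,u$, with $f_0:=e_1$. Writing $T:(x_0,x_1,x_2,x_3)$: $T_k:(e_k,e_{k+1},f_k,f_{k-1})$ of sign $+1$ ($1\le k\le p$); $U:(r,v,s,g)$ of sign $+1$; $V:(s,g,f_p,u)$ and $W:(u,v,r,e_{p+1})$ of sign $-1$. Angle structures: $\mathcal A_X$ is the set of $\alpha=(a_T,b_T,c_T)_{T\in X^3}$ with $a_T,b_T,c_T\in(0,\pi)$,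 $a_T+b_T+c_T=\pi$ ($a_T$ at edges $01,23$, $b_T$ at $02,13$, $c_T$ at $03,12$), such that for every $e\in X^1$ the angles at all tetrahedral edges identified to $e$ sum to $2\pi$. Indices $k$, $U$, $V$, $W$ refer to the tetrahedra $T_k,U,V,W$. Quantum dilogarithm: $\mathsf b>0$, $\hbar=(\mathsf b+\mathsf b^{-1})^{-2}$, $$\Phi_{\mathsf b}(z)=\exp\Big(\tfrac14\int_{\mathbb R+i0^+}\frac{e^{-2izw}\,dw}{\sinh(\mathsf bw)\sinh(\mathsf b^{-1}w)w}\Big)\quad\text{for }|\mathrm{Im}\,z|<\tfrac1{2\sqrt\hbar}$$ (contour: real line avoiding $0$ from above), extended meromorphically to $\mathbb C$. Partition function: attach real variables $t_T$ to tetrahedra and variables to faces (denoted by the names of the faces). The kinematical kernel is the tempered distribution on $\mathbb R^{X^3}$ $$\mathcal K_X(\mathbf t)=\int_{\mathbb R^{X^2}}d\mathbf x\prod_{T\in X^3}e^{2i\pi\varepsilon(T)x_0(T)t_T}\,\delta\big(x_0(T)-x_1(T)+x_2(T)\big)\,\delta\big(x_2(T)-x_3(T)+t_T\big),$$ where $x_i(T)$ denotes the component of $\mathbf x\in\mathbb R^{X^2}$ indexed by that face, and the Dirac deltas are understood via $\delta(x)=\int_{\mathbb R}e^{-2\pi ixw}dw$ (Fourier inversion). If the linear map $\mathbf x\mapsto A\mathbf x$ collecting the face-variable parts of the arguments of the deltas is invertible, this is the bounded function obtained by solving these linear equations for $\mathbf x$ and multiplying by $|\det A|^{-1}$. The dynamical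 content is $$\mathcal D_{\hbar,X}(\mathbf t,\alpha)=\prod_{T\in X^3}\frac{\exp(\hbar^{-1/2}c_Tt_T)}{\Phi_{\mathsf b}\big(t_T-\frac{i}{2\pi\sqrt\hbar}\varepsilon(T)(\pi-a_T)\big)^{\varepsilon(T)}},$$ and $\mathcal Z_\hbar(X,\alpha)=\int_{\mathbb R^{X^3}}\mathcal K_X(\mathbf t)\,\mathcal D_{\hbar,X}(\mathbf t,\alpha)\,d\mathbf t$. *)

theory Defs
  imports
    "HOL-Complex_Analysis.Complex_Analysis"
    "Jordan_Normal_Form.Determinant"
begin

text \<open>
  \<^term>\<open>opp_face X S k\<close> is the face of the tetrahedron \<open>S\<close> opposite to its vertex \<open>k\<close>
  (\<open>k \<le> 3\<close>).  Tetrahedra and faces are kept in (repetition-free) lists, because the matrix of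
  the face variables below needs an enumeration of its rows and columns.
\<close>

record ('t, 'f) triangulation =
  tets :: "'t list"
  faces :: "'f list"
  tet_sign :: "'t \<Rightarrow> int"
  opp_face :: "'t \<Rightarrow> nat \<Rightarrow> 'f"

text \<open>The edge joining vertices \<open>i < j\<close> of the tetrahedron \<open>S\<close>, before gluing, is \<open>(S, i, j)\<close>.\<close>

definition tet_edges :: "('t, 'f) triangulation \<Rightarrow> ('t \<times> nat \<times> nat) set" where
  "tet_edges X = {(S, i, j). S \<in> set (tets X) \<and> i < j \<and> j \<le> 3}"

text \<open>The \<open>m\<close>-th vertex (\<open>m \<le> 2\<close>), in increasing order, of the face opposite to vertex \<open>k\<close>.\<close>

definition face_vertex :: "nat \<Rightarrow> nat \<Rightarrow> nat" where
  "face_vertex k m = (if m < k then m else Suc m)"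

text \<open>Elementary edge identifications coming from the order-preserving gluing of faces with the
  same name; the case \<open>S = S'\<close>, \<open>k = k'\<close> only contributes trivial identifications.\<close>

definition edge_glue :: "('t, 'f) triangulation \<Rightarrow> (('t \<times> nat \<times> nat) \<times> ('t \<times> nat \<times> nat)) set" where
  "edge_glue X =
    {((S, face_vertex k m, face_vertex k l), (S', face_vertex k' m, face_vertex k' l)) |
       S S' k k' m l.
       S \<in> set (tets X) \<and> S' \<in> set (tets X) \<and> k \<le> 3 \<and> k' \<le> 3 \<and>
       opp_face X S k = opp_face X S' k' \<and> m < l \<and> l \<le> 2}"

definition edge_classes :: "('t, 'f) triangulation \<Rightarrow> ('t \<times> nat \<times> nat) set set" where
  "edge_classes X = tet_edges X // (edge_glue X)\<^sup>*"

type_synonym 't angles = "('t \<Rightarrow> real) \<times> ('t \<Rightarrow> real) \<times> ('t \<Rightarrow> real)"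

fun edge_angle :: "'t angles \<Rightarrow> 't \<times> nat \<times> nat \<Rightarrow> real" where
  "edge_angle (a, b, c) (S, i, j) =
    (if {i, j} = {0, 1} \<or> {i, j} = {2, 3} then a S
     else if {i, j} = {0, 2} \<or> {i, j} = {1, 3} then b S
     else c S)"

definition angle_structures :: "('t, 'f) triangulation \<Rightarrow> 't angles set" where
  "angle_structures X = {(a, b, c).
     (\<forall>S\<in>set (tets X). a S \<in> {0<..<pi} \<and> b S \<in> {0<..<pi} \<and> c S \<in> {0<..<pi} \<and>
        a S + b S + c S = pi) \<and>
     (\<forall>E\<in>edge_classes X. (\<Sum>e\<in>E. edge_angle (a, b, c) e) = 2 * pi)}"

definition hbar :: "real \<Rightarrow> real" where
  "hbar \<b> = 1 / (\<b> + 1 / \<b>)\<^sup>2"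

text \<open>The integral of \<open>f\<close> over the horizontal line \<open>\<real> + \<i> h\<close>.\<close>

definition line_integral :: "real \<Rightarrow> (complex \<Rightarrow> complex) \<Rightarrow> complex" where
  "line_integral h f = (LINT u|lborel. f (complex_of_real u + \<i> * complex_of_real h))"

definition qdilog_strip :: "real \<Rightarrow> complex set" where
  "qdilog_strip \<b> = {z. \<bar>Im z\<bar> < 1 / (2 * sqrt (hbar \<b>))}"

text \<open>The contour \<open>\<real> + \<i>0\<^sup>+\<close> is the limit of the lines \<open>\<real> + \<i> h\<close> for \<open>h\<close> tending to \<open>0\<close> from the right.\<close>

definition qdilog_formula :: "real \<Rightarrow> complex \<Rightarrow> complex" where
  "qdilog_formula \<b> z = exp (1 / 4 * Lim (at_right 0) (\<lambda>h. line_integral h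
     (\<lambda>w. exp (- 2 * \<i> * z * w) /
          (sinh (complex_of_real \<b> * w) * sinh (complex_of_real (1 / \<b>) * w) * w))))"

text \<open>Outside the strip the value is that of the meromorphic extension to the whole plane, which
  \<^const>\<open>nicely_meromorphic_on\<close> makes unique (removable singularities are removed and the value at
  a pole is \<open>0\<close>).\<close>

definition qdilog :: "real \<Rightarrow> complex \<Rightarrow> complex" where
  "qdilog \<b> z =
    (if z \<in> qdilog_strip \<b> then qdilog_formula \<b> z
     else (THE f. f nicely_meromorphic_on UNIV \<and>
                  (\<forall>w\<in>qdilog_strip \<b>. f w = qdilog_formula \<b> w)) z)"

text \<open>The arguments of the Dirac deltas: each tetrahedron, at position \<open>i\<close> in the list, contributes
  those numbered \<open>2 i\<close> and \<open>2 i + 1\<close>.\<close>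

definition delta_arg ::
    "('t, 'f) triangulation \<Rightarrow> nat \<Rightarrow> ('f \<Rightarrow> real) \<Rightarrow> ('t \<Rightarrow> real) \<Rightarrow> real" where
  "delta_arg X i x t =
    (let S = tets X ! (i div 2) in
     if even i
     then x (opp_face X S 0) - x (opp_face X S 1) + x (opp_face X S 2)
     else x (opp_face X S 2) - x (opp_face X S 3) + t S)"

text \<open>The matrix of the linear map \<open>x \<mapsto> A x\<close> formed by the face-variable parts of these arguments;
  column \<open>j\<close> is the image of the \<open>j\<close>-th basis vector.\<close>

definition face_matrix :: "('t, 'f) triangulation \<Rightarrow> real mat" where
  "face_matrix X = mat (2 * length (tets X)) (length (faces X))
     (\<lambda>(i, j). delta_arg X i (\<lambda>y. of_bool (y = faces X ! j)) (\<lambda>_. 0))"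

definition delta_solution :: "('t, 'f) triangulation \<Rightarrow> ('t \<Rightarrow> real) \<Rightarrow> 'f \<Rightarrow> real" where
  "delta_solution X t =
    (THE x. x \<in> extensional (set (faces X)) \<and> (\<forall>i < 2 * length (tets X). delta_arg X i x t = 0))"

text \<open>
  The kinematical kernel
  \[ \int dx \prod_S e^{2 \pi i \varepsilon(S) x_0(S) t_S}\, \delta(x_0(S) - x_1(S) + x_2(S))\,
     \delta(x_2(S) - x_3(S) + t_S) \]
  in the case where \<open>A\<close> is invertible, when this tempered distribution is a bounded function.
  When \<open>A\<close> is singular it is in general not a function and \<open>0\<close> is a dummy value.
  (\<^const>\<open>Determinant.det\<close> of a non-square matrix is \<open>0\<close>.)
\<close>

definition kinematical_kernel :: "('t, 'f) triangulation \<Rightarrow> ('t \<Rightarrow> real) \<Rightarrow> complex" where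
  "kinematical_kernel X t =
    (if Determinant.det (face_matrix X) = 0 then 0
     else (\<Prod>S\<in>set (tets X). exp (2 * \<i> * complex_of_real
              (pi * of_int (tet_sign X S) * delta_solution X t (opp_face X S 0) * t S)))
          / complex_of_real \<bar>Determinant.det (face_matrix X)\<bar>)"

fun dynamical_content ::
    "real \<Rightarrow> ('t, 'f) triangulation \<Rightarrow> 't angles \<Rightarrow> ('t \<Rightarrow> real) \<Rightarrow> complex" where
  "dynamical_content \<b> X (a, b, c) t =
    (\<Prod>S\<in>set (tets X).
       exp (complex_of_real (c S * t S / sqrt (hbar \<b>))) /
       qdilog \<b> (complex_of_real (t S) -
          \<i> * complex_of_real (of_int (tet_sign X S) * (pi - a S) / (2 * pi * sqrt (hbar \<b>))))
         powi tet_sign X S)"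

definition partition_function :: "real \<Rightarrow> ('t, 'f) triangulation \<Rightarrow> 't angles \<Rightarrow> complex" where
  "partition_function \<b> X \<alpha> =
    (LINT t|(\<Pi>\<^sub>M S\<in>set (tets X). lborel). kinematical_kernel X t * dynamical_content \<b> X \<alpha> t)"

datatype twist_tet = TT nat | TU | TV | TW

datatype twist_face = Fe nat | Ff nat | Fv | Fr | Fs | Fg | Fu

definition Ff0 :: "nat \<Rightarrow> twist_face" where
  "Ff0 k = (if k = 0 then Fe 1 else Ff k)"

fun twist_tet_faces :: "nat \<Rightarrow> twist_tet \<Rightarrow> twist_face list" where
  "twist_tet_faces p (TT k) = [Fe k, Fe (k + 1), Ff0 k, Ff0 (k - 1)]"
| "twist_tet_faces p TU = [Fr, Fv, Fs, Fg]"
| "twist_tet_faces p TV = [Fs, Fg, Ff0 p, Fu]"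
| "twist_tet_faces p TW = [Fu, Fv, Fr, Fe (p + 1)]"

fun twist_sign :: "twist_tet \<Rightarrow> int" where
  "twist_sign (TT k) = 1"
| "twist_sign TU = 1"
| "twist_sign TV = -1"
| "twist_sign TW = -1"

definition twist_triangulation :: "nat \<Rightarrow> (twist_tet, twist_face) triangulation" where
  "twist_triangulation n =
    (let p = (n - 2) div 2 in
     \<lparr> tets = map TT [1..<p + 1] @ [TU, TV, TW],
       faces = map Fe [1..<p + 2] @ map Ff [1..<p + 1] @ [Fv, Fr, Fs, Fg, Fu],
       tet_sign = twist_sign,
       opp_face = (\<lambda>S k. twist_tet_faces p S ! k) \<rparr>)"

definition twist_index :: "nat \<Rightarrow> twist_tet set" where
  "twist_index p = TT ` {1..p} \<union> {TU, TW}"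

fun twist_Q :: "nat \<Rightarrow> twist_tet \<Rightarrow> twist_tet \<Rightarrow> real" where
  "twist_Q p (TT j) (TT k) = real (min j k)"
| "twist_Q p (TT j) TU = real j"
| "twist_Q p TU (TT j) = real j"
| "twist_Q p TU TU = real p + 1"
| "twist_Q p TU TW = - 1 / 2"
| "twist_Q p TW TU = - 1 / 2"
| "twist_Q p _ _ = 0"

text \<open>The value at \<^const>\<open>TV\<close>, which is not an index of the vector, is a dummy.\<close>

fun twist_W :: "nat \<Rightarrow> twist_tet \<Rightarrow> real" where
  "twist_W p (TT k) = - 2 * pi * (real k * real p - real k * (real k - 1) / 2)"
| "twist_W p TU = - (real p ^ 2 + real p + 3) * pi"
| "twist_W p TW = pi"
| "twist_W p TV = 0"

text \<open>The height of the contour of the variable with index \<open>S\<close>, i.e. this variable runs over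
  \<open>\<real> + \<i> twist_height \<b> a S\<close>.\<close>

definition twist_height :: "real \<Rightarrow> (twist_tet \<Rightarrow> real) \<Rightarrow> twist_tet \<Rightarrow> real" where
  "twist_height \<b> a S =
    (if S = TW then (pi - a S) / (2 * pi * sqrt (hbar \<b>))
     else - (pi - a S) / (2 * pi * sqrt (hbar \<b>)))"

definition twist_J_integrand :: "real \<Rightarrow> nat \<Rightarrow> complex \<Rightarrow> (twist_tet \<Rightarrow> complex) \<Rightarrow> complex" where
  "twist_J_integrand \<b> p x y =
     exp (2 * \<i> * complex_of_real pi *
       (\<Sum>j\<in>twist_index p. \<Sum>k\<in>twist_index p. y j * complex_of_real (twist_Q p j k) * y k)) *
     exp (2 * \<i> * complex_of_real pi * x * (y TU - y TW - x)) *
     exp (complex_of_real (1 / sqrt (hbar \<b>)) *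
       ((\<Sum>k\<in>twist_index p. y k * complex_of_real (twist_W p k)) - complex_of_real pi * x)) *
     (qdilog \<b> (x - y TU) * qdilog \<b> (y TW) /
       ((\<Prod>k=1..p. qdilog \<b> (y (TT k))) * qdilog \<b> (y TU)))"

definition twist_J :: "real \<Rightarrow> nat \<Rightarrow> (twist_tet \<Rightarrow> real) \<Rightarrow> complex \<Rightarrow> complex" where
  "twist_J \<b> p a x =
    (LINT s|(\<Pi>\<^sub>M S\<in>twist_index p. lborel).
       twist_J_integrand \<b> p x
         (\<lambda>S. complex_of_real (s S) + \<i> * complex_of_real (twist_height \<b> a S)))"

end

theory Submission
  imports Defs "HOL-Real_Asymp.Real_Asymp"
begin

text \<open>
  Both sides are, up to a constant factor of modulus one, the same absolutely convergent integral over
  \<open>\<real>\<^sup>p\<^sup>+\<^sup>3\<close>, written in two linear coordinate systems.  No contour is deformed: the variables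
  \<open>y'\<close> and \<open>x\<close> have fixed imaginary parts, so only their real parts are integrated.

  The kernel.  The equations imposed by the deltas can be solved by back substitution, starting from
  \<open>f\<^sub>p\<close>, with all pivots \<open>\<plusminus>1\<close>.  Hence the matrix has determinant \<open>\<plusminus>1\<close>, and inserting the solution turns the
  kernel into \<open>exp (2 \<pi> \<i> q(t))\<close>, where \<open>q\<close> is the quadratic form \<open>y'\<^sup>T Q y' + x (y'\<^sub>U - y'\<^sub>W - x)\<close> evaluated at
  \<open>y'\<^sub>S = t\<^sub>S\<close> and \<open>x = t\<^sub>U + t\<^sub>V\<close> (\<open>kinematical_kernel_twist\<close>).

  The substitution.  Put \<open>t\<^sub>S = y'\<^sub>S - \<i> h\<^sub>S\<close> and \<open>t\<^sub>V = x - y'\<^sub>U - \<i> h\<^sub>V\<close>, where the \<open>h\<close> are the heights of the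
  contours.  The arguments of the quantum dilogarithms then agree.  Expanding \<open>q\<close> around the shifted point
  produces terms linear in \<open>y'\<close> and \<open>x\<close>, which are to be combined with the terms \<open>c\<^sub>S t\<^sub>S\<close> of the dynamical
  content.  The angle equations around the edges of the triangulation say precisely that the sum has the
  coefficients given by \<open>twist_W\<close> and by \<open>\<lambda>/2 - \<pi>\<close> (\<open>linear_coefficient_T\<close>, \<open>linear_coefficient_U\<close>,
  \<open>linear_coefficient_W\<close>, \<open>linear_coefficient_x\<close>).
  What is left is a constant, and it is purely imaginary (\<open>exponent_shift\<close>).  To know the equations one has
  to know the edges: a labelling of the edges of the tetrahedra by \<open>0, ..., p + 2\<close> that is invariant
  under the gluing separates those that are needed.

  Fubini.  In real coordinates the substitution is the shear \<open>t\<^sub>V = u - t\<^sub>U\<close>, and the right-hand side is an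
  iterated integral.  The interchange needs absolute convergence, which reduces to one tetrahedron at a time
  because the kernel has modulus one and the dynamical content is a product.  It rests on the
  behaviour of \<open>|\<Phi>\<^sub>b|\<close> along a horizontal line in the strip: bounded above and below at the left end, and comparable
  with \<open>exp (- 2 \<pi> Re z Im z)\<close> at the right end (\<open>ln_cmod_qdilog_asymp\<close>).  The first is read off the
  integral over a line above the real axis, the second from a line below it, the difference being the residue at
  the triple pole \<open>0\<close>.  With this, the factor of a tetrahedron decays like \<open>exp (c\<^sub>S t / \<surd>(hbar b))\<close> on the left and like
  \<open>exp (- b\<^sub>S t / \<surd>(hbar b))\<close> on the right, and all angles are positive.
\<close>

section \<open>Shifting a horizontal line of integration\<close>

lemma contour_integral_horizontal:
  assumes "l < r"
  shows "contour_integral (linepath (Complex l h) (Complex r h)) g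
       = integral {l..r} (\<lambda>u. g (complex_of_real u + \<i> * complex_of_real h))"
proof -
  have "contour_integral (linepath (Complex l h) (Complex r h)) g
      = contour_integral (linepath (complex_of_real l) (complex_of_real r)) (\<lambda>w. g (w + \<i> * complex_of_real h))"
    unfolding contour_integral_integral
    by (simp add: linepath_def Complex_eq scaleR_conv_of_real algebra_simps)
  also have "\<dots> = integral {l..r} (\<lambda>u. g (complex_of_real u + \<i> * complex_of_real h))"
    using assms by (subst contour_integral_linepath_Reals_eq) auto
  finally show ?thesis .
qed

lemma integral_Icc_tendsto_lborel:
  fixes f :: "real \<Rightarrow> complex"
  assumes f: "integrable lborel f"
  shows "(\<lambda>n. integral {- real n..real n} f) \<longlonglongrightarrow> (LINT u|lborel. f u)"
proof -
  have "(\<lambda>n. LINT u|lborel. indicator {- real n..real n} u *\<^sub>R f u) \<longlonglongrightarrow> (LINT u|lborel. f u)"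
  proof (rule integral_dominated_convergence)
    show "integrable lborel (\<lambda>u. norm (f u))" using f by simp
    show "AE u in lborel. (\<lambda>n. indicator {- real n..real n} u *\<^sub>R f u) \<longlonglongrightarrow> f u"
    proof (intro AE_I2 tendsto_eventually)
      fix u :: real
      obtain N :: nat where "\<bar>u\<bar> \<le> real N" using real_arch_simple by blast
      then show "\<forall>\<^sub>F n in sequentially. indicator {- real n..real n} u *\<^sub>R f u = f u"
        by (intro eventually_sequentiallyI[of N]) (auto simp: indicator_def)
    qed
  qed (use f in \<open>auto simp: indicator_def\<close>)
  also have "(\<lambda>n. LINT u|lborel. indicator {- real n..real n} u *\<^sub>R f u)
           = (\<lambda>n. integral {- real n..real n} f)"
  proof
    fix n
    have "set_integrable lborel {- real n..real n} f"
      unfolding set_integrable_def using f by (intro integrable_mult_indicator) auto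
    from set_borel_integral_eq_integral(2)[OF this]
    show "(LINT u|lborel. indicator {- real n..real n} u *\<^sub>R f u) = integral {- real n..real n} f"
      by (simp add: set_lebesgue_integral_def)
  qed
  finally show ?thesis .
qed

text \<open>
  The residue theorem on the rectangles with corners \<open>\<plusminus>n + \<i> h1\<close> and \<open>\<plusminus>n + \<i> h2\<close>: the decay of \<open>g\<close> makes the
  vertical sides vanish as \<open>n\<close> grows.
\<close>

lemma line_integral_shift:
  assumes holo: "g holomorphic_on {w. l < Im w \<and> Im w < r} - {0}"
    and h: "l < h1" "h1 < h2" "h2 < r" "h1 \<noteq> 0" "h2 \<noteq> 0"
    and int1: "integrable lborel (\<lambda>u. g (complex_of_real u + \<i> * complex_of_real h1))"
    and int2: "integrable lborel (\<lambda>u. g (complex_of_real u + \<i> * complex_of_real h2))"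
    and decay: "\<And>w. 1 \<le> \<bar>Re w\<bar> \<Longrightarrow> h1 \<le> Im w \<Longrightarrow> Im w \<le> h2 \<Longrightarrow> cmod (g w) \<le> C * exp (- d * \<bar>Re w\<bar>)"
    and d: "d > 0"
  shows "line_integral h1 g - line_integral h2 g
       = (if h1 < 0 \<and> 0 < h2 then 2 * pi * \<i> * residue g 0 else 0)"
proof -
  define S where "S = {w. l < Im w \<and> Im w < r}"
  have S_eq: "S = {w. l < Im w} \<inter> {w. Im w < r}" by (auto simp: S_def)
  have S: "open S" "convex S"
    unfolding S_eq by (auto intro!: open_halfspace_Im_gt open_halfspace_Im_lt convex_Int
        convex_halfspace_Im_gt convex_halfspace_Im_lt)
  have cont: "continuous_on (S - {0}) g"
    using holo unfolding S_def by (rule holomorphic_on_imp_continuous_on)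
  let ?res = "if h1 < 0 \<and> 0 < h2 then 2 * pi * \<i> * residue g 0 else 0"
  define I where "I h n = integral {- real n..real n} (\<lambda>u. g (complex_of_real u + \<i> * complex_of_real h))" for h n
  define V where "V n = contour_integral (linepath (Complex (real n) h1) (Complex (real n) h2)) g
      + contour_integral (linepath (Complex (- real n) h2) (Complex (- real n) h1)) g" for n
  have rect: "I h1 n - I h2 n + V n = ?res" if n: "n \<ge> 1" for n :: nat
  proof -
    define a1 a2 a3 a4 where "a1 = Complex (- real n) h1" and "a2 = Complex (real n) h1"
      and "a3 = Complex (real n) h2" and "a4 = Complex (- real n) h2"
    have seg: "closed_segment a1 a2 \<subseteq> S - {0}" "closed_segment a2 a3 \<subseteq> S - {0}"
      "closed_segment a3 a4 \<subseteq> S - {0}" "closed_segment a4 a1 \<subseteq> S - {0}"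
      using h n by (auto simp: a1_def a2_def a3_def a4_def S_def closed_segment_same_Im
          closed_segment_same_Re closed_segment_eq_real_ivl)
    note ci = contour_integrable_continuous_linepath[OF continuous_on_subset[OF cont]]
    have "contour_integral (rectpath a1 a3) g = contour_integral (linepath a1 a2) g
        + (contour_integral (linepath a2 a3) g + (contour_integral (linepath a3 a4) g
        + contour_integral (linepath a4 a1) g))"
      unfolding rectpath_def Let_def
      using ci[OF seg(1)] ci[OF seg(2)] ci[OF seg(3)] ci[OF seg(4)]
      by (simp add: a1_def a2_def a3_def a4_def)
    also have "contour_integral (linepath a1 a2) g = I h1 n"
      using n unfolding I_def a1_def a2_def by (intro contour_integral_horizontal) auto
    also have "contour_integral (linepath a3 a4) g = - contour_integral (linepath a4 a3) g"
      using seg(3) by (intro contour_integral_reverse_linepath continuous_on_subset[OF cont])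
    also have "contour_integral (linepath a4 a3) g = I h2 n"
      using n unfolding I_def a4_def a3_def by (intro contour_integral_horizontal) auto
    finally have "contour_integral (rectpath a1 a3) g = I h1 n - I h2 n + V n"
      by (simp add: V_def a1_def a2_def a3_def a4_def)
    moreover have "contour_integral (rectpath a1 a3) g
        = 2 * pi * \<i> * (\<Sum>p\<in>{0}. winding_number (rectpath a1 a3) p * residue g p)"
    proof (rule Residue_theorem)
      show "path_image (rectpath a1 a3) \<subseteq> S - {0}"
        using seg unfolding rectpath_def Let_def
        by (auto simp: path_image_join a1_def a2_def a3_def a4_def)
      show "\<forall>z. z \<notin> S \<longrightarrow> winding_number (rectpath a1 a3) z = 0"
        using h n by (auto intro!: winding_number_rectpath_outside
            simp: S_def a1_def a3_def in_cbox_complex_iff)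
    qed (use S holo in \<open>auto simp: S_def[symmetric] intro: convex_connected\<close>)
    moreover have "winding_number (rectpath a1 a3) 0 = (if h1 < 0 \<and> 0 < h2 then 1 else 0)"
    proof (cases "h1 < 0 \<and> 0 < h2")
      case True
      then show ?thesis using n
        by (auto intro!: winding_number_rectpath simp: a1_def a3_def in_box_complex_iff)
    next
      case False
      then show ?thesis using n h
        by (auto intro!: winding_number_rectpath_outside simp: a1_def a3_def in_cbox_complex_iff)
    qed
    ultimately show ?thesis by (auto split: if_splits)
  qed
  have "V \<longlonglongrightarrow> 0"
  proof (rule tendsto_0_le[where K = 1])
    show "(\<lambda>n. 2 * C * (h2 - h1) * exp (- d * real n)) \<longlonglongrightarrow> 0"
      using d by real_asymp
    \<comment> \<open>Both orientations occur, as the two vertical sides are traversed in opposite directions.\<close>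
    have vert: "cmod (contour_integral (linepath (Complex x y) (Complex x y')) g)
        \<le> C * exp (- d * real n) * (h2 - h1)"
      if "n \<ge> 1" "\<bar>x\<bar> = real n" "{y, y'} = {h1, h2}" for n :: nat and x y y'
    proof -
      have seg: "closed_segment (Complex x y) (Complex x y') \<subseteq> S - {0}"
        and im: "\<And>w. w \<in> closed_segment (Complex x y) (Complex x y') \<Longrightarrow> Re w = x \<and> h1 \<le> Im w \<and> Im w \<le> h2"
        using that h by (auto simp: S_def doubleton_eq_iff closed_segment_same_Re
            closed_segment_eq_real_ivl)
      have nrm: "norm (Complex x y' - Complex x y) = h2 - h1"
        using that h by (auto simp: doubleton_eq_iff cmod_def)
      have "cmod (contour_integral (linepath (Complex x y) (Complex x y')) g)
          \<le> C * exp (- d * real n) * norm (Complex x y' - Complex x y)"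
      proof (rule contour_integral_bound_linepath)
        show "g contour_integrable_on linepath (Complex x y) (Complex x y')"
          by (rule contour_integrable_continuous_linepath[OF continuous_on_subset[OF cont seg]])
        show bd: "cmod (g w) \<le> C * exp (- d * real n)"
          if "w \<in> closed_segment (Complex x y) (Complex x y')" for w
          using im[OF that] decay[of w] \<open>\<bar>x\<bar> = real n\<close> \<open>n \<ge> 1\<close> by auto
        show "0 \<le> C * exp (- d * real n)"
          using bd[of "Complex x y"] norm_ge_zero order_trans by (metis ends_in_segment(1))
      qed
      then show ?thesis by (simp only: nrm)
    qed
    show "\<forall>\<^sub>F n in sequentially. norm (V n) \<le> norm (2 * C * (h2 - h1) * exp (- d * real n)) * 1"
    proof (rule eventually_sequentiallyI[of 1])
      fix n :: nat assume n: "1 \<le> n"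
      have "norm (V n) \<le> C * exp (- d * real n) * (h2 - h1) + C * exp (- d * real n) * (h2 - h1)"
        unfolding V_def using n by (intro norm_triangle_mono vert) auto
      also have "\<dots> = 2 * C * (h2 - h1) * exp (- d * real n)" by simp
      finally show "norm (V n) \<le> norm (2 * C * (h2 - h1) * exp (- d * real n)) * 1" by simp
    qed
  qed
  moreover have "(\<lambda>n. I h1 n) \<longlonglongrightarrow> line_integral h1 g" "(\<lambda>n. I h2 n) \<longlonglongrightarrow> line_integral h2 g"
    unfolding I_def line_integral_def by (rule integral_Icc_tendsto_lborel; fact)+
  ultimately have "(\<lambda>n. I h1 n - I h2 n + V n) \<longlonglongrightarrow> line_integral h1 g - line_integral h2 g + 0"
    by (intro tendsto_intros)
  moreover have "(\<lambda>n. I h1 n - I h2 n + V n) \<longlonglongrightarrow> ?res"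
    using rect by (intro tendsto_eventually eventually_sequentiallyI[of 1])
  ultimately show ?thesis using LIMSEQ_unique by fastforce
qed

section \<open>The integrand defining the quantum dilogarithm\<close>

definition qdilog_kernel :: "real \<Rightarrow> complex \<Rightarrow> complex \<Rightarrow> complex" where
  "qdilog_kernel \<b> z w = exp (- 2 * \<i> * z * w) /
     (sinh (complex_of_real \<b> * w) * sinh (complex_of_real (1 / \<b>) * w) * w)"

lemma cmod_sinh_squared: "(cmod (sinh w))\<^sup>2 = (sinh (Re w))\<^sup>2 + (sin (Im w))\<^sup>2"
proof -
  have "(cmod (sinh w))\<^sup>2 = (exp (2 * Re w) + inverse (exp (2 * Re w)) - 2 * cos (2 * Im w)) / 4"
    using norm_sin_squared[of "\<i> * w"] by (simp add: sinh_conv_sin norm_mult)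
  also have "exp (2 * Re w) = (exp (Re w))\<^sup>2"
    by (simp add: exp_double)
  also have "cos (2 * Im w) = 1 - 2 * (sin (Im w))\<^sup>2"
    by (simp add: cos_double_sin)
  also have "((exp (Re w))\<^sup>2 + inverse ((exp (Re w))\<^sup>2) - 2 * (1 - 2 * (sin (Im w))\<^sup>2)) / 4
      = (sinh (Re w))\<^sup>2 + (sin (Im w))\<^sup>2"
    by (simp add: sinh_field_def exp_minus field_simps power2_eq_square)
  finally show ?thesis .
qed

text \<open>
  Since \<open>|sinh w|\<^sup>2 = sinh\<^sup>2 (Re w) + sin\<^sup>2 (Im w) \<ge> sin\<^sup>2 (Im w) cosh\<^sup>2 (Re w)\<close>, this bound is uniform on a
  whole horizontal line, but degenerates as the line approaches the real axis.
\<close>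

lemma cmod_sinh_ge_sin: "\<bar>sin (Im w)\<bar> * exp \<bar>Re w\<bar> / 2 \<le> cmod (sinh w)"
proof (rule power2_le_imp_le)
  have "exp \<bar>Re w\<bar> / 2 \<le> cosh (Re w)"
    by (auto simp: cosh_field_def abs_if)
  then have "(exp \<bar>Re w\<bar> / 2)\<^sup>2 \<le> (cosh (Re w))\<^sup>2"
    by (rule power_mono) simp
  then have "(sin (Im w))\<^sup>2 * (exp \<bar>Re w\<bar> / 2)\<^sup>2 \<le> (sin (Im w))\<^sup>2 * (cosh (Re w))\<^sup>2"
    by (rule mult_left_mono) simp
  also have "\<dots> = (sin (Im w))\<^sup>2 + (sin (Im w))\<^sup>2 * (sinh (Re w))\<^sup>2"
    by (simp add: cosh_square_eq algebra_simps)
  also have "\<dots> \<le> (sin (Im w))\<^sup>2 + 1 * (sinh (Re w))\<^sup>2"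
    by (intro add_left_mono mult_right_mono) (auto simp: abs_square_le_1)
  finally show "(\<bar>sin (Im w)\<bar> * exp \<bar>Re w\<bar> / 2)\<^sup>2 \<le> (cmod (sinh w))\<^sup>2"
    by (simp add: cmod_sinh_squared power_mult_distrib power_divide)
qed simp

text \<open>
  The complementary bound, uniform in the height but only away from the imaginary axis; it controls the
  vertical sides of rectangles that cross the real axis.
\<close>

lemma cmod_sinh_ge_away:
  assumes "m \<le> \<bar>Re w\<bar>" "m > 0"
  shows "(1 - exp (- 2 * m)) * exp \<bar>Re w\<bar> / 2 \<le> cmod (sinh w)"
proof -
  have "exp (- \<bar>Re w\<bar>) = exp (- 2 * \<bar>Re w\<bar>) * exp \<bar>Re w\<bar>"
    by (simp flip: exp_add)
  also have "\<dots> \<le> exp (- 2 * m) * exp \<bar>Re w\<bar>"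
    using assms by simp
  finally have "(1 - exp (- 2 * m)) * exp \<bar>Re w\<bar> / 2 \<le> sinh \<bar>Re w\<bar>"
    by (simp add: sinh_field_def field_simps)
  also have "sinh \<bar>Re w\<bar> = \<bar>sinh (Re w)\<bar>" by simp
  also have "\<dots> \<le> cmod (sinh w)"
    by (rule power2_le_imp_le) (simp_all add: cmod_sinh_squared)
  finally show ?thesis .
qed

lemma cmod_exp_kernel: "cmod (exp (- 2 * \<i> * z * w)) = exp (2 * (Re z * Im w + Im z * Re w))"
  by (simp add: norm_exp_eq_Re)

lemma qdilog_kernel_norm_le:
  assumes b: "\<b> > 0"
    and s1: "0 < s1" "s1 * exp (\<b> * \<bar>Re w\<bar>) / 2 \<le> cmod (sinh (complex_of_real \<b> * w))"
    and s2: "0 < s2" "s2 * exp (\<bar>Re w\<bar> / \<b>) / 2 \<le> cmod (sinh (complex_of_real (1 / \<b>) * w))"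
    and s3: "0 < s3" "s3 \<le> cmod w"
  shows "cmod (qdilog_kernel \<b> z w)
    \<le> 4 / (s1 * s2 * s3) * exp (2 * Re z * Im w) * exp (- (\<b> + 1 / \<b> - 2 * \<bar>Im z\<bar>) * \<bar>Re w\<bar>)"
proof -
  have "cmod (qdilog_kernel \<b> z w) = exp (2 * (Re z * Im w + Im z * Re w)) /
      (cmod (sinh (complex_of_real \<b> * w)) * cmod (sinh (complex_of_real (1 / \<b>) * w)) * cmod w)"
    unfolding qdilog_kernel_def norm_divide norm_mult cmod_exp_kernel ..
  also have "\<dots> \<le> exp (2 * (Re z * Im w + \<bar>Im z\<bar> * \<bar>Re w\<bar>)) /
      ((s1 * exp (\<b> * \<bar>Re w\<bar>) / 2) * (s2 * exp (\<bar>Re w\<bar> / \<b>) / 2) * s3)"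
  proof (rule frac_le)
    have "Im z * Re w \<le> \<bar>Im z\<bar> * \<bar>Re w\<bar>" by (metis abs_ge_self abs_mult)
    then show "exp (2 * (Re z * Im w + Im z * Re w)) \<le> exp (2 * (Re z * Im w + \<bar>Im z\<bar> * \<bar>Re w\<bar>))"
      by simp
    show "(s1 * exp (\<b> * \<bar>Re w\<bar>) / 2) * (s2 * exp (\<bar>Re w\<bar> / \<b>) / 2) * s3
      \<le> cmod (sinh (complex_of_real \<b> * w)) * cmod (sinh (complex_of_real (1 / \<b>) * w)) * cmod w"
      using s1 s2 s3 by (intro mult_mono) (auto intro: mult_nonneg_nonneg)
    show "0 < (s1 * exp (\<b> * \<bar>Re w\<bar>) / 2) * (s2 * exp (\<bar>Re w\<bar> / \<b>) / 2) * s3"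
      using s1 s2 s3 by simp
  qed simp
  also have "\<dots> = 4 / (s1 * s2 * s3) *
      (exp (2 * (Re z * Im w + \<bar>Im z\<bar> * \<bar>Re w\<bar>)) / (exp (\<b> * \<bar>Re w\<bar>) * exp (\<bar>Re w\<bar> / \<b>)))"
    by (simp add: mult_ac)
  also have "exp (2 * (Re z * Im w + \<bar>Im z\<bar> * \<bar>Re w\<bar>)) / (exp (\<b> * \<bar>Re w\<bar>) * exp (\<bar>Re w\<bar> / \<b>))
      = exp (2 * Re z * Im w) * exp (- (\<b> + 1 / \<b> - 2 * \<bar>Im z\<bar>) * \<bar>Re w\<bar>)"
    unfolding exp_add[symmetric] exp_diff[symmetric] by (simp add: algebra_simps)
  finally show ?thesis by (simp add: mult.assoc)
qed

lemma sin_nonzero_unit: "x \<noteq> 0 \<Longrightarrow> \<bar>x\<bar> < 1 \<Longrightarrow> sin x \<noteq> (0::real)"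
  using sin_gt_zero[of x] sin_gt_zero[of "-x"] pi_gt3 by (cases "x > 0") auto

text \<open>
  The strip of half-width \<open>min \<b> (1 / \<b>)\<close> is a convenient one in which \<open>0\<close> is the only singularity of the
  integrand: both hyperbolic sines have arguments with imaginary part of modulus below \<open>1 < \<pi>\<close> there.
\<close>

lemma scaled_strip_lt_1:
  assumes "\<b> > 0" "\<bar>y\<bar> < min \<b> (1 / \<b>)"
  shows "\<bar>\<b> * y\<bar> < 1" "\<bar>y / \<b>\<bar> < (1::real)"
  using assms by (auto simp: abs_mult field_simps)

lemma sinh_nonzero_strip:
  assumes "w \<noteq> 0" "\<bar>Im w\<bar> < 1"
  shows "sinh w \<noteq> 0"
proof
  assume "sinh w = 0"
  then have "sinh (Re w) = 0" "sin (Im w) = 0"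
    using cmod_sinh_squared[of w] by (simp_all add: sum_power2_eq_zero_iff)
  then have "w = 0"
    using sin_nonzero_unit[of "Im w"] assms(2) by (auto simp: complex_eq_iff)
  with assms(1) show False by simp
qed

text \<open>
  The constant does not depend on \<open>z\<close>; the factor \<open>exp (2 * Re z * h)\<close> is what makes a line with \<open>h > 0\<close>
  useful for \<open>Re z \<le> 0\<close> and a line with \<open>h < 0\<close> useful for \<open>Re z \<ge> 0\<close>.
\<close>

lemma qdilog_kernel_line_bound:
  assumes b: "\<b> > 0" and h: "h \<noteq> 0" "\<bar>h\<bar> < min \<b> (1 / \<b>)"
  obtains C where "C > 0" "\<And>z u. cmod (qdilog_kernel \<b> z (complex_of_real u + \<i> * complex_of_real h))
    \<le> C * exp (2 * Re z * h) * exp (- (\<b> + 1 / \<b> - 2 * \<bar>Im z\<bar>) * \<bar>u\<bar>)"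
proof
  define s1 s2 where "s1 = \<bar>sin (\<b> * h)\<bar>" and "s2 = \<bar>sin (h / \<b>)\<bar>"
  have s: "0 < s1" "0 < s2"
    using scaled_strip_lt_1[OF b h(2)] h(1) b sin_nonzero_unit[of "\<b> * h"] sin_nonzero_unit[of "h / \<b>"]
    by (auto simp: s1_def s2_def)
  show "4 / (s1 * s2 * \<bar>h\<bar>) > 0" using s h by simp
  fix z u
  let ?w = "complex_of_real u + \<i> * complex_of_real h"
  have 1: "s1 * exp (\<b> * \<bar>Re ?w\<bar>) / 2 \<le> cmod (sinh (complex_of_real \<b> * ?w))"
    using cmod_sinh_ge_sin[of "complex_of_real \<b> * ?w"] b by (simp add: s1_def abs_mult)
  have 2: "s2 * exp (\<bar>Re ?w\<bar> / \<b>) / 2 \<le> cmod (sinh (complex_of_real (1 / \<b>) * ?w))"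
    using cmod_sinh_ge_sin[of "complex_of_real (1 / \<b>) * ?w"] b
    by (simp add: s2_def abs_mult)
  have 3: "\<bar>h\<bar> \<le> cmod ?w"
    using abs_Im_le_cmod[of ?w] by simp
  show "cmod (qdilog_kernel \<b> z ?w)
    \<le> 4 / (s1 * s2 * \<bar>h\<bar>) * exp (2 * Re z * h) * exp (- (\<b> + 1 / \<b> - 2 * \<bar>Im z\<bar>) * \<bar>u\<bar>)"
    using qdilog_kernel_norm_le[OF b s(1) 1 s(2) 2 _ 3, of z] h by simp
qed

lemma qdilog_kernel_decay:
  assumes b: "\<b> > 0"
  obtains C where "\<And>w. 1 \<le> \<bar>Re w\<bar> \<Longrightarrow> \<bar>Im w\<bar> \<le> h \<Longrightarrow>
     cmod (qdilog_kernel \<b> z w) \<le> C * exp (- (\<b> + 1 / \<b> - 2 * \<bar>Im z\<bar>) * \<bar>Re w\<bar>)"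
proof
  define s1 s2 where "s1 = 1 - exp (- 2 * \<b>)" and "s2 = 1 - exp (- 2 * (1 / \<b>))"
  have s: "0 < s1" "0 < s2" using b by (auto simp: s1_def s2_def)
  fix w assume w: "1 \<le> \<bar>Re w\<bar>" "\<bar>Im w\<bar> \<le> h"
  have 1: "s1 * exp (\<b> * \<bar>Re w\<bar>) / 2 \<le> cmod (sinh (complex_of_real \<b> * w))"
    using cmod_sinh_ge_away[of \<b> "complex_of_real \<b> * w"] b w(1) by (simp add: s1_def abs_mult)
  have 2: "s2 * exp (\<bar>Re w\<bar> / \<b>) / 2 \<le> cmod (sinh (complex_of_real (1 / \<b>) * w))"
    using cmod_sinh_ge_away[of "1 / \<b>" "complex_of_real (1 / \<b>) * w"] b w(1)
    by (simp add: s2_def abs_mult divide_right_mono)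
  have 3: "1 \<le> cmod w" using w(1) abs_Re_le_cmod[of w] by linarith
  have "2 * Re z * Im w \<le> 2 * \<bar>Re z\<bar> * h"
  proof -
    have "Re z * Im w \<le> \<bar>Re z\<bar> * \<bar>Im w\<bar>" using abs_ge_self[of "Re z * Im w"] by (simp add: abs_mult)
    also have "\<dots> \<le> \<bar>Re z\<bar> * h" using w(2) by (intro mult_left_mono) auto
    finally show ?thesis by simp
  qed
  then have "4 / (s1 * s2 * 1) * exp (2 * Re z * Im w) * exp (- (\<b> + 1 / \<b> - 2 * \<bar>Im z\<bar>) * \<bar>Re w\<bar>)
    \<le> 4 / (s1 * s2 * 1) * exp (2 * \<bar>Re z\<bar> * h) * exp (- (\<b> + 1 / \<b> - 2 * \<bar>Im z\<bar>) * \<bar>Re w\<bar>)"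
    using s by (intro mult_right_mono mult_left_mono) auto
  with qdilog_kernel_norm_le[OF b s(1) 1 s(2) 2 _ 3, of z]
  show "cmod (qdilog_kernel \<b> z w)
    \<le> 4 / (s1 * s2 * 1) * exp (2 * \<bar>Re z\<bar> * h) * exp (- (\<b> + 1 / \<b> - 2 * \<bar>Im z\<bar>) * \<bar>Re w\<bar>)"
    by simp
qed

lemma integrable_exp_minus_abs:
  assumes "d > 0"
  shows "integrable lborel (\<lambda>u. exp (- d * \<bar>u\<bar>) :: real)"
proof -
  have "set_integrable lebesgue {0..} (\<lambda>x. exp (- d * x) :: real)"
    using assms by (intro nonnegative_absolutely_integrable_1 integrable_on_exp_minus_to_infinity) auto
  then have pos: "integrable lborel (\<lambda>x. indicator {0..} x * exp (- d * x) :: real)"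
    by (subst (asm) set_integrable_def, subst (asm) integrable_completion) auto
  have neg: "integrable lborel (\<lambda>x. indicator {0..} (0 + (-1) * x) * exp (- d * (0 + (-1) * x)) :: real)"
    by (rule lborel_integrable_real_affine[OF pos]) simp
  show ?thesis
    by (rule Bochner_Integration.integrable_bound[OF Bochner_Integration.integrable_add[OF pos neg]])
       (auto simp: indicator_def abs_if)
qed

lemma measurable_qdilog_kernel [measurable]:
  "(\<lambda>(z, w). qdilog_kernel \<b> z w) \<in> borel_measurable (borel \<Otimes>\<^sub>M borel)"
  unfolding qdilog_kernel_def sinh_field_def by measurable

lemma qdilog_kernel_integrable:
  assumes b: "\<b> > 0" and h: "h \<noteq> 0" "\<bar>h\<bar> < min \<b> (1 / \<b>)" and z: "2 * \<bar>Im z\<bar> < \<b> + 1 / \<b>"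
  shows "integrable lborel (\<lambda>u. qdilog_kernel \<b> z (complex_of_real u + \<i> * complex_of_real h))"
proof -
  obtain C where C: "\<And>z u. cmod (qdilog_kernel \<b> z (complex_of_real u + \<i> * complex_of_real h))
    \<le> C * exp (2 * Re z * h) * exp (- (\<b> + 1 / \<b> - 2 * \<bar>Im z\<bar>) * \<bar>u\<bar>)"
    using qdilog_kernel_line_bound[OF b h] by metis
  show ?thesis
  proof (rule Bochner_Integration.integrable_bound)
    show "integrable lborel (\<lambda>u. C * exp (2 * Re z * h) * exp (- (\<b> + 1 / \<b> - 2 * \<bar>Im z\<bar>) * \<bar>u\<bar>))"
      using z by (intro integrable_mult_right integrable_exp_minus_abs) simp
    show "(\<lambda>u. qdilog_kernel \<b> z (complex_of_real u + \<i> * complex_of_real h)) \<in> borel_measurable lborel"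
      unfolding qdilog_kernel_def sinh_field_def by measurable
    show "AE u in lborel. cmod (qdilog_kernel \<b> z (complex_of_real u + \<i> * complex_of_real h))
        \<le> norm (C * exp (2 * Re z * h) * exp (- (\<b> + 1 / \<b> - 2 * \<bar>Im z\<bar>) * \<bar>u\<bar>))"
      using C by (intro AE_I2) (metis abs_ge_self order_trans real_norm_def)
  qed
qed

lemma sinh_mult_holomorphic: "(\<lambda>w. sinh (c * w :: complex)) holomorphic_on A"
  unfolding sinh_field_def by (intro holomorphic_intros) auto

lemma qdilog_kernel_holomorphic:
  assumes b: "\<b> > 0"
  shows "qdilog_kernel \<b> z holomorphic_on
    {w. - min \<b> (1 / \<b>) < Im w \<and> Im w < min \<b> (1 / \<b>)} - {0}"
  unfolding qdilog_kernel_def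
proof (intro holomorphic_intros sinh_mult_holomorphic)
  fix w assume "w \<in> {w. - min \<b> (1 / \<b>) < Im w \<and> Im w < min \<b> (1 / \<b>)} - {0}"
  then have w: "w \<noteq> 0" "\<bar>Im w\<bar> < min \<b> (1 / \<b>)" by auto
  have "sinh (complex_of_real \<b> * w) \<noteq> 0" "sinh (complex_of_real (1 / \<b>) * w) \<noteq> 0"
    using scaled_strip_lt_1[OF b w(2)] w(1) b sinh_nonzero_strip[of "complex_of_real \<b> * w"]
      sinh_nonzero_strip[of "complex_of_real (1 / \<b>) * w"] by auto
  with w show "sinh (complex_of_real \<b> * w) * sinh (complex_of_real (1 / \<b>) * w) * w \<noteq> 0" by simp
qed

lemma qdilog_kernel_line_shift:
  assumes b: "\<b> > 0" and z: "2 * \<bar>Im z\<bar> < \<b> + 1 / \<b>"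
    and h: "h1 < h2" "h1 \<noteq> 0" "h2 \<noteq> 0" "\<bar>h1\<bar> < min \<b> (1 / \<b>)" "\<bar>h2\<bar> < min \<b> (1 / \<b>)"
  shows "line_integral h1 (qdilog_kernel \<b> z) - line_integral h2 (qdilog_kernel \<b> z)
    = (if h1 < 0 \<and> 0 < h2 then 2 * pi * \<i> * residue (qdilog_kernel \<b> z) 0 else 0)"
proof -
  obtain C where C: "\<And>w. 1 \<le> \<bar>Re w\<bar> \<Longrightarrow> \<bar>Im w\<bar> \<le> max \<bar>h1\<bar> \<bar>h2\<bar> \<Longrightarrow>
     cmod (qdilog_kernel \<b> z w) \<le> C * exp (- (\<b> + 1 / \<b> - 2 * \<bar>Im z\<bar>) * \<bar>Re w\<bar>)"
    using qdilog_kernel_decay[OF b] by metis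
  show ?thesis
  proof (rule line_integral_shift[OF qdilog_kernel_holomorphic[OF b]])
    show "cmod (qdilog_kernel \<b> z w) \<le> C * exp (- (\<b> + 1 / \<b> - 2 * \<bar>Im z\<bar>) * \<bar>Re w\<bar>)"
      if "1 \<le> \<bar>Re w\<bar>" "h1 \<le> Im w" "Im w \<le> h2" for w
      using that by (intro C) auto
    show "integrable lborel (\<lambda>u. qdilog_kernel \<b> z (complex_of_real u + \<i> * complex_of_real h1))"
      "integrable lborel (\<lambda>u. qdilog_kernel \<b> z (complex_of_real u + \<i> * complex_of_real h2))"
      by (rule qdilog_kernel_integrable[OF b _ _ z]; fact h)+
    show "- min \<b> (1 / \<b>) < h1" "h2 < min \<b> (1 / \<b>)" using h(4,5) by linarith+
    show "0 < \<b> + 1 / \<b> - 2 * \<bar>Im z\<bar>" using z by simp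
  qed (rule h)+
qed

text \<open>
  The entire function \<open>sinh w / w\<close>.  Dividing the integrand by the two copies of it isolates the triple pole as
  an explicit factor \<open>1 / w\<^sup>3\<close>.
\<close>

definition sinhc :: "complex \<Rightarrow> complex" where
  "sinhc w = (if w = 0 then 1 else sinh w / w)"

lemma sinhc_holomorphic: "sinhc holomorphic_on A"
proof -
  have "deriv sinh (0::complex) = 1"
    by (rule DERIV_imp_deriv) (auto intro!: derivative_eq_intros)
  then have "(\<lambda>z. if z = 0 then deriv sinh 0 else (sinh z - sinh 0) / (z - 0)) = sinhc"
    by (auto simp: sinhc_def)
  moreover have "(\<lambda>z::complex. if z = 0 then deriv sinh 0 else (sinh z - sinh 0) / (z - 0)) holomorphic_on UNIV"
    by (intro pole_lemma_open sinh_mult_holomorphic[of 1, simplified]) auto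
  ultimately show ?thesis by (metis holomorphic_on_subset subset_UNIV)
qed

lemma sinhc_uminus: "sinhc (- w) = sinhc w" by (simp add: sinhc_def)

lemma sinhc_nonzero: "\<bar>Im w\<bar> < 1 \<Longrightarrow> sinhc w \<noteq> 0"
  using sinh_nonzero_strip[of w] by (auto simp: sinhc_def)

text \<open>
  The residue is the coefficient of \<open>w\<^sup>2\<close> in \<open>exp (- 2 \<i> z w) H(w)\<close> for a holomorphic \<open>H\<close> with \<open>H 0 = 1\<close> that
  is even, so that there is no term linear in \<open>z\<close>.  The number \<open>r\<close> only
  contributes a constant factor to the asymptotics of \<open>\<Phi>\<^sub>b\<close>.
\<close>

lemma residue_qdilog_kernel:
  assumes b: "\<b> > 0"
  shows "\<exists>r. \<forall>z. residue (qdilog_kernel \<b> z) 0 = r - 2 * z\<^sup>2"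
proof -
  define H where "H w = 1 / (sinhc (complex_of_real \<b> * w) * sinhc (complex_of_real (1 / \<b>) * w))" for w
  define S where "S = ball (0::complex) (min \<b> (1 / \<b>))"
  have S0: "0 \<in> S" "open S" using b by (auto simp: S_def)
  have holH: "H holomorphic_on S"
    unfolding H_def
  proof (intro holomorphic_intros)
    show "(\<lambda>w. sinhc (complex_of_real c * w)) holomorphic_on S" for c
      using holomorphic_on_compose[of "\<lambda>w. complex_of_real c * w" S sinhc] sinhc_holomorphic
      by (auto simp: o_def intro: holomorphic_intros)
    then show "(\<lambda>w. sinhc (complex_of_real (1 / \<b>) * w)) holomorphic_on S" .
    fix w assume "w \<in> S"
    then have w: "\<bar>Im w\<bar> < min \<b> (1 / \<b>)"
      unfolding S_def using abs_Im_le_cmod[of w] by auto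
    then show "sinhc (complex_of_real \<b> * w) * sinhc (complex_of_real (1 / \<b>) * w) \<noteq> 0"
      using scaled_strip_lt_1[OF b w] by (auto intro!: sinhc_nonzero)
  qed
  then have "H analytic_on {0}" using S0 analytic_at by blast
  then have F: "H has_fps_expansion fps_expansion H 0"
    by (rule analytic_at_imp_has_fps_expansion_0)
  define F where "F = fps_expansion H 0"
  have "H 0 = 1" by (simp add: H_def sinhc_def)
  then have F0: "fps_nth F 0 = 1" by (simp add: F_def fps_expansion_def)
  have "deriv H 0 = 0"
  proof -
    have D: "(H has_field_derivative deriv H 0) (at 0)"
      using holH S0 holomorphic_derivI by blast
    have even: "(\<lambda>w. H (- w)) = H" by (simp add: H_def sinhc_uminus fun_eq_iff)
    have "((\<lambda>w. H (- w)) has_field_derivative deriv H 0 * (- 1)) (at 0)"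
      by (rule DERIV_chain'[where f = uminus and g = H]) (use D in \<open>auto intro!: derivative_eq_intros\<close>)
    then have "deriv H 0 = - deriv H 0"
      using D unfolding even by (simp add: DERIV_unique)
    then show ?thesis by simp
  qed
  then have F1: "fps_nth F 1 = 0" by (simp add: F_def fps_expansion_def)
  have "residue (qdilog_kernel \<b> z) 0 = fps_nth F 2 - 2 * z\<^sup>2" for z
  proof -
    have exp: "(\<lambda>w. exp (- 2 * \<i> * z * w)) has_fps_expansion fps_exp (- 2 * \<i> * z)"
      by (rule has_fps_expansion_exp)
    have "residue (qdilog_kernel \<b> z) 0 = residue (\<lambda>w. (exp (- 2 * \<i> * z * w) * H w) / w ^ Suc 2) 0"
    proof (rule residue_cong)
      have "qdilog_kernel \<b> z w = (exp (- 2 * \<i> * z * w) * H w) / w ^ Suc 2" if "w \<noteq> 0" for w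
        using that b by (simp add: qdilog_kernel_def H_def sinhc_def power3_eq_cube)
      then show "\<forall>\<^sub>F w in at 0. qdilog_kernel \<b> z w = (exp (- 2 * \<i> * z * w) * H w) / w ^ Suc 2"
        by (auto simp: eventually_at_filter)
    qed simp
    also have "\<dots> = fps_nth (fps_exp (- 2 * \<i> * z) * F) 2"
      by (rule residue_fps_expansion_over_power_at_0)
         (use has_fps_expansion_mult[OF exp F[folded F_def]] in simp)
    also have "\<dots> = fps_nth F 2 - 2 * z\<^sup>2"
      using F0 F1 by (simp add: fps_mult_nth numeral_2_eq_2 power2_eq_square)
    finally show ?thesis .
  qed
  then show ?thesis by blast
qed

section \<open>The modulus of the quantum dilogarithm on horizontal lines\<close>

lemma sqrt_hbar: "\<b> > 0 \<Longrightarrow> sqrt (hbar \<b>) = 1 / (\<b> + 1 / \<b>)"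
  by (simp add: hbar_def real_sqrt_divide)

lemma qdilog_strip_iff: "\<b> > 0 \<Longrightarrow> z \<in> qdilog_strip \<b> \<longleftrightarrow> 2 * \<bar>Im z\<bar> < \<b> + 1 / \<b>"
  by (auto simp: qdilog_strip_def sqrt_hbar)

text \<open>
  The integral over the line of height \<open>h\<close> does not depend on small positive \<open>h\<close>, so the limit in the
  definition is attained.
\<close>

lemma qdilog_eq_line_integral:
  assumes b: "\<b> > 0" and z: "2 * \<bar>Im z\<bar> < \<b> + 1 / \<b>" and h: "0 < h" "h < min \<b> (1 / \<b>)"
  shows "qdilog \<b> z = exp (1 / 4 * line_integral h (qdilog_kernel \<b> z))"
proof -
  have eq: "line_integral h' (qdilog_kernel \<b> z) = line_integral h (qdilog_kernel \<b> z)"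
    if "0 < h'" "h' < h" for h'
    using qdilog_kernel_line_shift[OF b z, of h' h] that h by simp
  have "((\<lambda>h. line_integral h (qdilog_kernel \<b> z)) \<longlongrightarrow> line_integral h (qdilog_kernel \<b> z)) (at_right 0)"
    by (rule tendsto_eventually, rule eventually_at_rightI[of 0 h]) (use eq h in auto)
  then have "Lim (at_right 0) (\<lambda>h. line_integral h (qdilog_kernel \<b> z)) = line_integral h (qdilog_kernel \<b> z)"
    by (intro tendsto_Lim) auto
  then show ?thesis
    using z b by (simp add: qdilog_def qdilog_strip_iff qdilog_formula_def qdilog_kernel_def[abs_def])
qed

lemma half_strip_height: "\<b> > 0 \<Longrightarrow> 0 < min \<b> (1 / \<b>) / 2" "\<b> > 0 \<Longrightarrow> min \<b> (1 / \<b>) / 2 < min \<b> (1 / \<b>)"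
  for \<b> :: real
proof -
  assume "\<b> > 0"
  then have "0 < min \<b> (1 / \<b>)" by simp
  moreover have "0 < m / 2 \<and> m / 2 < m" if "0 < m" for m :: real using that by simp
  ultimately show "0 < min \<b> (1 / \<b>) / 2" "min \<b> (1 / \<b>) / 2 < min \<b> (1 / \<b>)" by blast+
qed

lemma qdilog_nonzero:
  assumes "\<b> > 0" "2 * \<bar>Im z\<bar> < \<b> + 1 / \<b>"
  shows "qdilog \<b> z \<noteq> 0"
  using qdilog_eq_line_integral[OF assms half_strip_height] assms(1) by simp

lemma measurable_qdilog_line:
  assumes b: "\<b> > 0" and y: "2 * \<bar>y\<bar> < \<b> + 1 / \<b>"
  shows "(\<lambda>t. qdilog \<b> (complex_of_real t + \<i> * complex_of_real y)) \<in> borel_measurable lborel"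
proof -
  define h where "h = min \<b> (1 / \<b>) / 2"
  have h: "0 < h" "h < min \<b> (1 / \<b>)" using half_strip_height[OF b] by (auto simp: h_def)
  have "(\<lambda>t. qdilog \<b> (complex_of_real t + \<i> * complex_of_real y)) =
    (\<lambda>t. exp (1 / 4 * (LINT u|lborel. qdilog_kernel \<b> (complex_of_real t + \<i> * complex_of_real y)
        (complex_of_real u + \<i> * complex_of_real h))))"
    using qdilog_eq_line_integral[OF b _ h] y by (simp add: line_integral_def fun_eq_iff)
  also have "\<dots> \<in> borel_measurable lborel" by measurable
  finally show ?thesis .
qed

lemma cmod_line_integral_qdilog_kernel_le:
  assumes b: "\<b> > 0" and h: "h \<noteq> 0" "\<bar>h\<bar> < min \<b> (1 / \<b>)" and y: "2 * \<bar>y\<bar> < \<b> + 1 / \<b>"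
  shows "\<exists>C. \<forall>t. t * h \<le> 0 \<longrightarrow>
    cmod (line_integral h (qdilog_kernel \<b> (complex_of_real t + \<i> * complex_of_real y))) \<le> C"
proof -
  obtain C where C: "C > 0" "\<And>z u. cmod (qdilog_kernel \<b> z (complex_of_real u + \<i> * complex_of_real h))
    \<le> C * exp (2 * Re z * h) * exp (- (\<b> + 1 / \<b> - 2 * \<bar>Im z\<bar>) * \<bar>u\<bar>)"
    using qdilog_kernel_line_bound[OF b h] by metis
  define d where "d = \<b> + 1 / \<b> - 2 * \<bar>y\<bar>"
  have d: "d > 0" using y by (simp add: d_def)
  show ?thesis
  proof (intro exI allI impI)
    fix t :: real assume t: "t * h \<le> 0"
    let ?z = "complex_of_real t + \<i> * complex_of_real y"
    have "cmod (line_integral h (qdilog_kernel \<b> ?z))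
      \<le> (LINT u|lborel. cmod (qdilog_kernel \<b> ?z (complex_of_real u + \<i> * complex_of_real h)))"
      unfolding line_integral_def by (rule integral_norm_bound)
    also have "\<dots> \<le> (LINT u|lborel. C * exp (- d * \<bar>u\<bar>))"
    proof (rule integral_mono)
      show "integrable lborel (\<lambda>u. cmod (qdilog_kernel \<b> ?z (complex_of_real u + \<i> * complex_of_real h)))"
        using y by (intro integrable_norm qdilog_kernel_integrable[OF b h]) simp
      show "integrable lborel (\<lambda>u. C * exp (- d * \<bar>u\<bar>))"
        using d by (intro integrable_mult_right integrable_exp_minus_abs)
      fix u
      have "cmod (qdilog_kernel \<b> ?z (complex_of_real u + \<i> * complex_of_real h))
          \<le> C * exp (2 * (t * h)) * exp (- d * \<bar>u\<bar>)"
        using C(2)[of ?z u] by (simp add: d_def mult.assoc)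
      also have "\<dots> \<le> C * 1 * exp (- d * \<bar>u\<bar>)"
        using t C(1) by (intro mult_right_mono mult_left_mono) (simp_all add: mult.commute)
      finally show "cmod (qdilog_kernel \<b> ?z (complex_of_real u + \<i> * complex_of_real h))
          \<le> C * exp (- d * \<bar>u\<bar>)" by simp
    qed
    finally show "cmod (line_integral h (qdilog_kernel \<b> ?z)) \<le> (LINT u|lborel. C * exp (- d * \<bar>u\<bar>))" .
  qed
qed

text \<open>
  For \<open>t \<ge> 0\<close>, crossing the pole at \<open>0\<close> contributes
  \<open>Re (- 2 \<pi> \<i> (r - 2 z\<^sup>2)) / 4 = const - 2 \<pi> t y\<close> to the logarithm of the modulus at \<open>z = t + \<i> y\<close>.
\<close>

lemma ln_cmod_qdilog_asymp:
  assumes b: "\<b> > 0" and y: "2 * \<bar>y\<bar> < \<b> + 1 / \<b>"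
  shows "\<exists>C. \<forall>t. \<bar>ln (cmod (qdilog \<b> (complex_of_real t + \<i> * complex_of_real y)))
      + 2 * pi * y * max 0 t\<bar> \<le> C"
proof -
  define h where "h = min \<b> (1 / \<b>) / 2"
  have h: "0 < h" "h < min \<b> (1 / \<b>)" using half_strip_height[OF b] by (auto simp: h_def)
  define z where "z t = complex_of_real t + \<i> * complex_of_real y" for t
  have im: "2 * \<bar>Im (z t)\<bar> < \<b> + 1 / \<b>" for t using y by (simp add: z_def)
  obtain C1 where C1: "\<And>t. t \<le> 0 \<Longrightarrow> cmod (line_integral h (qdilog_kernel \<b> (z t))) \<le> C1"
    using cmod_line_integral_qdilog_kernel_le[OF b _ _ y, of h] h
    by (auto simp: z_def mult_le_0_iff)
  obtain C2 where C2: "\<And>t. t \<ge> 0 \<Longrightarrow> cmod (line_integral (- h) (qdilog_kernel \<b> (z t))) \<le> C2"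
    using cmod_line_integral_qdilog_kernel_le[OF b _ _ y, of "- h"] h
    by (auto simp: z_def mult_le_0_iff zero_le_mult_iff)
  obtain r where r: "\<And>z. residue (qdilog_kernel \<b> z) 0 = r - 2 * z\<^sup>2"
    using residue_qdilog_kernel[OF b] by blast
  have ln_eq: "ln (cmod (qdilog \<b> (z t))) = Re (line_integral h (qdilog_kernel \<b> (z t))) / 4" for t
    using qdilog_eq_line_integral[OF b im h] by (simp add: norm_exp_eq_Re)
  have "\<bar>ln (cmod (qdilog \<b> (z t))) + 2 * pi * y * max 0 t\<bar>
      \<le> \<bar>C1\<bar> + \<bar>C2\<bar> + \<bar>Re (2 * pi * \<i> * r)\<bar>" for t
  proof (cases "t \<le> 0")
    case True
    have "\<bar>Re (line_integral h (qdilog_kernel \<b> (z t)))\<bar> \<le> C1"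
      using C1[OF True] abs_Re_le_cmod order_trans by blast
    then show ?thesis using True by (simp add: ln_eq)
  next
    case False
    have "line_integral h (qdilog_kernel \<b> (z t))
        = line_integral (- h) (qdilog_kernel \<b> (z t)) - 2 * pi * \<i> * (r - 2 * (z t)\<^sup>2)"
      using qdilog_kernel_line_shift[OF b im, of "- h" h t] h r by (simp add: algebra_simps)
    then have "Re (line_integral h (qdilog_kernel \<b> (z t)))
        = Re (line_integral (- h) (qdilog_kernel \<b> (z t)) - 2 * pi * \<i> * (r - 2 * (z t)\<^sup>2))"
      by (rule arg_cong)
    also have "\<dots> = Re (line_integral (- h) (qdilog_kernel \<b> (z t))) - Re (2 * pi * \<i> * r) - 4 * (2 * pi * y * t)"
      by (simp add: z_def power2_eq_square algebra_simps)
    finally have "Re (line_integral h (qdilog_kernel \<b> (z t)))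
        = Re (line_integral (- h) (qdilog_kernel \<b> (z t))) - Re (2 * pi * \<i> * r) - 4 * (2 * pi * y * t)" .
    moreover have "\<bar>Re (line_integral (- h) (qdilog_kernel \<b> (z t)))\<bar> \<le> C2"
      using C2[of t] False abs_Re_le_cmod order_trans by (metis linorder_not_le less_imp_le)
    moreover have "\<bar>a / 4 + k\<bar> \<le> \<bar>C1\<bar> + \<bar>C2\<bar> + \<bar>m\<bar>" if "a = a' - m - 4 * k" "\<bar>a'\<bar> \<le> C2" for a a' k m :: real
      using that by (simp add: field_simps)
    ultimately have "\<bar>Re (line_integral h (qdilog_kernel \<b> (z t))) / 4 + 2 * pi * y * t\<bar>
        \<le> \<bar>C1\<bar> + \<bar>C2\<bar> + \<bar>Re (2 * pi * \<i> * r)\<bar>" by blast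
    moreover have "max 0 t = t" using False by simp
    ultimately show ?thesis by (simp only: ln_eq)
  qed
  then show ?thesis unfolding z_def by blast
qed

text \<open>
  At height \<open>- \<epsilon> (\<pi> - \<alpha>) / (2 \<pi> \<surd>(hbar b))\<close>, the modulus of \<open>\<Phi>\<^sub>b\<close> to the power \<open>- \<epsilon>\<close> behaves like \<open>1\<close> on
  the left and like \<open>exp (- (\<pi> - \<alpha>) t / \<surd>(hbar b))\<close> on the right.  As \<open>\<gamma> - (\<pi> - \<alpha>) = - \<beta>\<close>, the factor decays
  exponentially with rate \<open>\<gamma> / \<surd>(hbar b)\<close> on the left and \<open>\<beta> / \<surd>(hbar b)\<close> on the right.
\<close>

lemma integrable_tetrahedron_factor:
  fixes \<epsilon> :: int
  assumes b: "\<b> > 0" and ang: "0 < \<alpha>" "0 < \<beta>" "0 < \<gamma>" "\<alpha> + \<beta> + \<gamma> = pi" and \<epsilon>: "\<epsilon> = 1 \<or> \<epsilon> = -1"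
  shows "integrable lborel (\<lambda>t. exp (complex_of_real (\<gamma> * t / sqrt (hbar \<b>))) /
       qdilog \<b> (complex_of_real t -
          \<i> * complex_of_real (of_int \<epsilon> * (pi - \<alpha>) / (2 * pi * sqrt (hbar \<b>)))) powi \<epsilon>)"
proof -
  define Q where "Q = \<b> + 1 / \<b>"
  have Q: "Q > 0" "sqrt (hbar \<b>) = 1 / Q" using b by (auto simp: Q_def sqrt_hbar intro: add_pos_pos)
  define y where "y = - of_int \<epsilon> * (pi - \<alpha>) * Q / (2 * pi)"
  have "2 * \<bar>y\<bar> = (pi - \<alpha>) * Q / pi"
    using \<epsilon> ang Q by (auto simp: y_def abs_mult)
  also have "\<dots> < Q" using ang Q by (simp add: field_simps)
  finally have y: "2 * \<bar>y\<bar> < \<b> + 1 / \<b>" by (simp add: Q_def)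
  have arg: "complex_of_real t - \<i> * complex_of_real (of_int \<epsilon> * (pi - \<alpha>) / (2 * pi * sqrt (hbar \<b>)))
      = complex_of_real t + \<i> * complex_of_real y" for t
    by (simp add: y_def Q)
  define \<Phi> where "\<Phi> t = qdilog \<b> (complex_of_real t + \<i> * complex_of_real y)" for t
  have \<Phi>0: "\<Phi> t \<noteq> 0" for t using qdilog_nonzero[OF b] y by (simp add: \<Phi>_def)
  obtain C where C: "\<And>t. \<bar>ln (cmod (\<Phi> t)) + 2 * pi * y * max 0 t\<bar> \<le> C"
    using ln_cmod_qdilog_asymp[OF b y] unfolding \<Phi>_def by blast
  have meas: "\<Phi> \<in> borel_measurable lborel"
    unfolding \<Phi>_def by (rule measurable_qdilog_line[OF b y])
  define d where "d = min \<beta> \<gamma> * Q"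
  have "integrable lborel (\<lambda>t. exp (complex_of_real (\<gamma> * t * Q)) / \<Phi> t powi \<epsilon>)"
  proof (rule Bochner_Integration.integrable_bound)
    show "integrable lborel (\<lambda>t. exp C * exp (- d * \<bar>t\<bar>))"
      using ang Q by (intro integrable_mult_right integrable_exp_minus_abs) (simp add: d_def)
    show "(\<lambda>t. exp (complex_of_real (\<gamma> * t * Q)) / \<Phi> t powi \<epsilon>) \<in> borel_measurable lborel"
      using \<epsilon> meas by (auto simp: power_int_minus)
    show "AE t in lborel. cmod (exp (complex_of_real (\<gamma> * t * Q)) / \<Phi> t powi \<epsilon>) \<le> norm (exp C * exp (- d * \<bar>t\<bar>))"
    proof (rule AE_I2)
      fix t
      have "cmod (\<Phi> t powi \<epsilon>) = exp (of_int \<epsilon> * ln (cmod (\<Phi> t)))"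
        using \<epsilon> \<Phi>0[of t] by (auto simp: norm_inverse power_int_minus exp_minus)
      then have "cmod (exp (complex_of_real (\<gamma> * t * Q)) / \<Phi> t powi \<epsilon>)
          = exp (\<gamma> * t * Q - of_int \<epsilon> * ln (cmod (\<Phi> t)))"
        by (simp add: norm_divide exp_diff norm_exp_eq_Re)
      also have "\<gamma> * t * Q - of_int \<epsilon> * ln (cmod (\<Phi> t)) \<le> C - d * \<bar>t\<bar>"
      proof -
        have "- (of_int \<epsilon> * ln (cmod (\<Phi> t))) \<le> C + of_int \<epsilon> * (2 * pi * y * max 0 t)"
          using \<epsilon> C[of t] by auto
        also have "of_int \<epsilon> * (2 * pi * y * max 0 t) = - ((pi - \<alpha>) * Q * max 0 t)"
          using \<epsilon> by (auto simp: y_def)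
        also have "pi - \<alpha> = \<beta> + \<gamma>" using ang by simp
        finally have *: "\<gamma> * t * Q - of_int \<epsilon> * ln (cmod (\<Phi> t)) \<le> C + \<gamma> * t * Q - (\<beta> + \<gamma>) * Q * max 0 t"
          by (simp add: algebra_simps)
        have m1: "min \<beta> \<gamma> * (Q * \<bar>t\<bar>) \<le> \<beta> * (Q * \<bar>t\<bar>)" and m2: "min \<beta> \<gamma> * (Q * \<bar>t\<bar>) \<le> \<gamma> * (Q * \<bar>t\<bar>)"
          using Q(1) by (auto intro!: mult_right_mono)
        show ?thesis
        proof (cases "t \<ge> 0")
          case True then show ?thesis using * m1 by (simp add: d_def algebra_simps)
        next
          case False then show ?thesis using * m2 by (simp add: d_def algebra_simps)
        qed
      qed
      finally show "cmod (exp (complex_of_real (\<gamma> * t * Q)) / \<Phi> t powi \<epsilon>) \<le> norm (exp C * exp (- d * \<bar>t\<bar>))"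
        by (simp flip: exp_add)
    qed
  qed
  then show ?thesis unfolding arg \<Phi>_def by (simp add: Q)
qed

section \<open>Fubini after a shear\<close>

text \<open>
  A bound by a product of integrable functions of one variable makes \<open>G\<close> integrable, and it is inherited by
  the sheared function: integrating it over \<open>u\<close> first gives the same value for every \<open>s\<close> as without the shear.
\<close>

lemma integral_shear:
  fixes G :: "('i \<Rightarrow> real) \<Rightarrow> complex" and g :: "'i \<Rightarrow> real \<Rightarrow> real"
  assumes I: "finite I" "i \<notin> I" "j \<in> I"
    and meas: "G \<in> borel_measurable (Pi\<^sub>M (insert i I) (\<lambda>_. lborel))"
    and g: "\<And>k. k \<in> insert i I \<Longrightarrow> integrable lborel (g k)"
    and bound: "\<And>t. cmod (G t) \<le> (\<Prod>k\<in>insert i I. g k (t k))"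
  shows "(LINT t|Pi\<^sub>M (insert i I) (\<lambda>_. lborel). G t)
    = (LINT u|lborel. LINT s|Pi\<^sub>M I (\<lambda>_. lborel). G (s(i := u - s j)))"
proof -
  interpret P: product_sigma_finite "\<lambda>_::'i. lborel :: real measure" ..
  interpret F: finite_product_sigma_finite "\<lambda>_::'i. lborel :: real measure" I by standard (rule I)
  interpret PP: pair_sigma_finite "Pi\<^sub>M I (\<lambda>_. lborel :: real measure)" "lborel :: real measure" ..
  let ?M = "Pi\<^sub>M I (\<lambda>_. lborel :: real measure)"
  have [measurable]: "(\<lambda>s. s j) \<in> borel_measurable ?M"
    using measurable_component_singleton[OF I(3), of "\<lambda>_. lborel"] by simp
  have [measurable]: "(\<lambda>s. \<Prod>k\<in>I. g k (s k)) \<in> borel_measurable ?M"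
    using P.product_integrable_prod[OF I(1), of g] g by (intro borel_measurable_integrable) auto
  have [measurable]: "g i \<in> borel_measurable borel"
    using g[of i] borel_measurable_integrable by fastforce
  have upd: "(\<lambda>(s, u). s(i := u - s j)) \<in> measurable (?M \<Otimes>\<^sub>M lborel) (Pi\<^sub>M (insert i I) (\<lambda>_. lborel))"
    unfolding case_prod_beta by (rule measurable_fun_upd[where J = I]) (use I in auto)
  have measf: "(\<lambda>(s, u). G (s(i := u - s j))) \<in> borel_measurable (?M \<Otimes>\<^sub>M lborel)"
    using measurable_compose[OF upd meas] by (simp add: case_prod_beta)
  have intG: "integrable (Pi\<^sub>M (insert i I) (\<lambda>_. lborel)) G"
  proof (rule Bochner_Integration.integrable_bound)
    show "integrable (Pi\<^sub>M (insert i I) (\<lambda>_. lborel)) (\<lambda>t. \<Prod>k\<in>insert i I. g k (t k))"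
      by (rule P.product_integrable_prod) (use I g in auto)
    show "AE t in Pi\<^sub>M (insert i I) (\<lambda>_. lborel). cmod (G t) \<le> norm (\<Prod>k\<in>insert i I. g k (t k))"
      using bound by (intro AE_I2) (metis abs_ge_self order_trans real_norm_def)
  qed (rule meas)
  have trans: "integrable lborel (\<lambda>u. h (u - c))" "(LINT u|lborel. h (u - c)) = (LINT u|lborel. h u)"
    if "integrable lborel h" for h :: "real \<Rightarrow> real" and c
    using lborel_integrable_real_affine[OF that, of 1 "- c"] lborel_integral_real_affine[of 1 h "- c"] by simp_all
  have inth: "integrable (?M \<Otimes>\<^sub>M lborel) (\<lambda>(s, u). (\<Prod>k\<in>I. g k (s k)) * g i (u - s j))"
  proof (rule PP.Fubini_integrable)
    have "(LINT u|lborel. norm ((\<Prod>k\<in>I. g k (s k)) * g i (u - s j)))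
      = norm (\<Prod>k\<in>I. g k (s k)) * (LINT u|lborel. norm (g i u))" for s
      using trans(2)[of "\<lambda>u. norm (g i u)" "s j"] g[of i] by (simp add: abs_mult)
    moreover have "integrable ?M (\<lambda>s. norm (\<Prod>k\<in>I. g k (s k)) * (LINT u|lborel. norm (g i u)))"
      by (intro integrable_mult_left integrable_norm P.product_integrable_prod) (use I g in auto)
    ultimately show "integrable ?M (\<lambda>s. LINT u|lborel. norm (case (s, u) of (s, u) \<Rightarrow> (\<Prod>k\<in>I. g k (s k)) * g i (u - s j)))"
      by simp
    show "AE s in ?M. integrable lborel (\<lambda>u. case (s, u) of (s, u) \<Rightarrow> (\<Prod>k\<in>I. g k (s k)) * g i (u - s j))"
      using trans(1)[OF g[of i]] by (intro AE_I2) auto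
  qed measurable
  have intf: "integrable (?M \<Otimes>\<^sub>M lborel) (\<lambda>(s, u). G (s(i := u - s j)))"
  proof (rule Bochner_Integration.integrable_bound[OF inth measf], rule AE_I2)
    fix z :: "('i \<Rightarrow> real) \<times> real"
    obtain s u where z: "z = (s, u)" by (cases z)
    have "(\<Prod>k\<in>I. g k ((s(i := u - s j)) k)) = (\<Prod>k\<in>I. g k (s k))"
      using I by (intro prod.cong) auto
    then have "(\<Prod>k\<in>insert i I. g k ((s(i := u - s j)) k)) = (\<Prod>k\<in>I. g k (s k)) * g i (u - s j)"
      using I by simp
    then show "norm (case z of (s, u) \<Rightarrow> G (s(i := u - s j)))
      \<le> norm (case z of (s, u) \<Rightarrow> (\<Prod>k\<in>I. g k (s k)) * g i (u - s j))"
      using bound[of "s(i := u - s j)"] by (simp add: z del: fun_upd_apply)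
  qed
  have "(LINT t|Pi\<^sub>M (insert i I) (\<lambda>_. lborel). G t) = (LINT s|?M. LINT v|lborel. G (s(i := v)))"
    by (rule P.product_integral_insert[OF I(1,2) intG])
  also have "\<dots> = (LINT s|?M. LINT u|lborel. G (s(i := u - s j)))"
  proof (rule Bochner_Integration.integral_cong[OF refl])
    show "(LINT v|lborel. G (s(i := v))) = (LINT u|lborel. G (s(i := u - s j)))" for s
      using lborel_integral_real_affine[of 1 "\<lambda>v. G (s(i := v))" "- s j"] by simp
  qed
  also have "\<dots> = (LINT u|lborel. LINT s|?M. G (s(i := u - s j)))"
    using PP.Fubini_integral[OF intf] by simp
  finally show ?thesis .
qed

section \<open>The kinematical kernel of a twist knot triangulation\<close>

text \<open>
  Solvability over \<open>\<int>\<close> for every unit vector provides an integral inverse matrix, so the determinant is a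
  unit of \<open>\<int>\<close>.
\<close>

lemma abs_det_eq_1:
  fixes A :: "real mat"
  assumes A: "A \<in> carrier_mat m m" and int: "\<And>i j. i < m \<Longrightarrow> j < m \<Longrightarrow> A $$ (i, j) \<in> \<int>"
    and solv: "\<And>k. k < m \<Longrightarrow> \<exists>x. (\<forall>j<m. x j \<in> \<int>) \<and>
      (\<forall>i<m. (\<Sum>j<m. A $$ (i, j) * x j) = of_bool (i = k))"
  shows "\<bar>Determinant.det A\<bar> = 1"
proof -
  obtain X where X: "\<And>k j. k < m \<Longrightarrow> j < m \<Longrightarrow> X k j \<in> \<int>"
    "\<And>k i. k < m \<Longrightarrow> i < m \<Longrightarrow> (\<Sum>j<m. A $$ (i, j) * X k j) = of_bool (i = k)"
    using solv by metis
  define B where "B = mat m m (\<lambda>(j, k). X k j)"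
  have B: "B \<in> carrier_mat m m" by (simp add: B_def)
  have "A * B = 1\<^sub>m m"
    using A by (intro eq_matI) (auto simp: B_def scalar_prod_def X(2) lessThan_atLeast0[symmetric])
  then have "Determinant.det A * Determinant.det B = 1"
    using det_mult[OF A B] by simp
  moreover have "Determinant.det M \<in> \<int>"
    if "M \<in> carrier_mat m m" "\<And>i j. i < m \<Longrightarrow> j < m \<Longrightarrow> M $$ (i, j) \<in> \<int>" for M :: "real mat"
    unfolding det_def'[OF that(1)]
    by (intro Ints_sum Ints_mult Ints_prod that(2)) (auto simp: sign_def permutes_in_image)
  then have "Determinant.det A \<in> \<int>" "Determinant.det B \<in> \<int>"
    using A B int X(1) by (auto simp: B_def)
  ultimately obtain u v :: int where u: "Determinant.det A = of_int u" "Determinant.det B = of_int v"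
    and "real_of_int u * real_of_int v = 1" by (metis Ints_cases)
  then have "u * v = 1" by (metis of_int_eq_1_iff of_int_mult)
  then have "\<bar>u\<bar> = 1" by (simp add: zmult_eq_1_iff abs_if) auto
  then show ?thesis using u by (metis of_int_1 of_int_abs)
qed

lemma face_matrix_mult_vec:
  assumes "distinct (faces X)" "\<And>S k. S \<in> set (tets X) \<Longrightarrow> k \<le> 3 \<Longrightarrow> opp_face X S k \<in> set (faces X)"
    and i: "i < 2 * length (tets X)"
  shows "(\<Sum>j<length (faces X). face_matrix X $$ (i, j) * x (faces X ! j)) = delta_arg X i x (\<lambda>_. 0)"
proof -
  define S where "S = tets X ! (i div 2)"
  have S: "S \<in> set (tets X)" using i by (simp add: S_def)
  have pick: "(\<Sum>j\<in>{..<length (faces X)} \<inter> {j. y = faces X ! j}. x (faces X ! j)) = x y"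
    if y: "y \<in> set (faces X)" for y
  proof -
    obtain j0 where j0: "j0 < length (faces X)" "faces X ! j0 = y" using y unfolding in_set_conv_nth by blast
    then have "{..<length (faces X)} \<inter> {j. y = faces X ! j} = {j0}"
      using assms(1) by (auto simp: nth_eq_iff_index_eq)
    then show ?thesis using j0 by simp
  qed
  have mem: "opp_face X S k \<in> set (faces X)" if "k \<le> 3" for k using assms(2)[OF S that] .
  have "(\<Sum>j<length (faces X). face_matrix X $$ (i, j) * x (faces X ! j))
    = (\<Sum>j<length (faces X). delta_arg X i (\<lambda>y. of_bool (y = faces X ! j)) (\<lambda>_. 0) * x (faces X ! j))"
    using i by (intro sum.cong) (simp_all add: face_matrix_def)
  also have "\<dots> = delta_arg X i x (\<lambda>_. 0)"
  proof (cases "even i")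
    case True
    then show ?thesis
      unfolding delta_arg_def Let_def S_def[symmetric]
      by (simp add: left_diff_distrib distrib_right sum.distrib sum_subtractf pick mem)
  next
    case False
    then show ?thesis
      unfolding delta_arg_def Let_def S_def[symmetric]
      by (simp add: left_diff_distrib sum_subtractf pick mem)
  qed
  finally show ?thesis .
qed

text \<open>
  Back substitution for arbitrary right-hand sides: \<open>\<rho> S\<close> and \<open>\<sigma> S\<close> belong to the first and the second delta of
  the tetrahedron \<open>S\<close>.  The equations of \<open>U\<close> and \<open>V\<close> give \<open>f\<^sub>p\<close>, those of the \<open>T\<^sub>k\<close> give the \<open>f\<^sub>k\<close> downwards and
  then, from \<open>e\<^sub>1 = f\<^sub>0\<close>, the \<open>e\<^sub>k\<close> upwards; the other faces follow.  General right-hand sides are needed for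
  the determinant, and those with \<open>\<rho> = 0\<close> and \<open>\<sigma> S = - t S\<close> for the kernel.
\<close>

definition twist_solution ::
    "nat \<Rightarrow> (twist_tet \<Rightarrow> real) \<Rightarrow> (twist_tet \<Rightarrow> real) \<Rightarrow> twist_face \<Rightarrow> real" where
  "twist_solution p \<rho> \<sigma> =
    (let f = (\<lambda>k. \<rho> TV - \<sigma> TU - (\<Sum>j=k+1..p. \<sigma> (TT j)));
         e = (\<lambda>k. f 0 + (\<Sum>j=1..<k. f j - \<rho> (TT j)));
         u = f p - \<sigma> TV; r = e (p + 1) + \<sigma> TW; v = u + r - \<rho> TW; s = \<rho> TU - r + v
     in case_twist_face e f v r s (s - \<sigma> TU) u)"

definition twist_equations ::
    "nat \<Rightarrow> (twist_face \<Rightarrow> real) \<Rightarrow> (twist_tet \<Rightarrow> real) \<Rightarrow> (twist_tet \<Rightarrow> real) \<Rightarrow> bool" where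
  "twist_equations p x \<rho> \<sigma> \<longleftrightarrow> (\<forall>S \<in> TT ` {1..p} \<union> {TU, TV, TW}.
     (let F = twist_tet_faces p S in
      x (F ! 0) - x (F ! 1) + x (F ! 2) = \<rho> S \<and> x (F ! 2) - x (F ! 3) = \<sigma> S))"

definition twist_faces :: "nat \<Rightarrow> twist_face set" where
  "twist_faces p = Fe ` {1..p+1} \<union> Ff ` {1..p} \<union> {Fv, Fr, Fs, Fg, Fu}"

lemma twist_solution_Ff0: "twist_solution p \<rho> \<sigma> (Ff0 k) = \<rho> TV - \<sigma> TU - (\<Sum>j=k+1..p. \<sigma> (TT j))"
  by (simp add: twist_solution_def Let_def Ff0_def)

lemma twist_equations_solution: "twist_equations p (twist_solution p \<rho> \<sigma>) \<rho> \<sigma>"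
proof -
  have "twist_solution p \<rho> \<sigma> (Fe k) - twist_solution p \<rho> \<sigma> (Fe (k + 1)) + twist_solution p \<rho> \<sigma> (Ff0 k) = \<rho> (TT k)"
    "twist_solution p \<rho> \<sigma> (Ff0 k) - twist_solution p \<rho> \<sigma> (Ff0 (k - 1)) = \<sigma> (TT k)"
    if "k \<in> {1..p}" for k
  proof -
    have 1: "{1..<k + 1} = insert k {1..<k}" using that by auto
    show "twist_solution p \<rho> \<sigma> (Fe k) - twist_solution p \<rho> \<sigma> (Fe (k + 1)) + twist_solution p \<rho> \<sigma> (Ff0 k) = \<rho> (TT k)"
      unfolding twist_solution_Ff0 by (simp add: twist_solution_def Let_def 1[simplified])
    have "{k - 1 + 1..p} = insert k {k+1..p}" using that by auto
    then show "twist_solution p \<rho> \<sigma> (Ff0 k) - twist_solution p \<rho> \<sigma> (Ff0 (k - 1)) = \<sigma> (TT k)"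
      unfolding twist_solution_Ff0 by simp
  qed
  moreover have "twist_solution p \<rho> \<sigma> (Ff0 p) = \<rho> TV - \<sigma> TU"
    by (simp add: twist_solution_Ff0)
  moreover have "twist_solution p \<rho> \<sigma> Fu = twist_solution p \<rho> \<sigma> (Ff0 p) - \<sigma> TV"
    "twist_solution p \<rho> \<sigma> Fr = twist_solution p \<rho> \<sigma> (Fe (p + 1)) + \<sigma> TW"
    "twist_solution p \<rho> \<sigma> Fv = twist_solution p \<rho> \<sigma> Fu + twist_solution p \<rho> \<sigma> Fr - \<rho> TW"
    "twist_solution p \<rho> \<sigma> Fs = \<rho> TU - twist_solution p \<rho> \<sigma> Fr + twist_solution p \<rho> \<sigma> Fv"
    "twist_solution p \<rho> \<sigma> Fg = twist_solution p \<rho> \<sigma> Fs - \<sigma> TU"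
    by (simp_all only: twist_solution_Ff0) (simp_all add: twist_solution_def Let_def)
  ultimately show ?thesis
    by (auto simp: twist_equations_def Let_def numeral_2_eq_2 numeral_3_eq_3)
qed

lemma twist_equations_unique:
  assumes "twist_equations p x \<rho> \<sigma>" "y \<in> twist_faces p"
  shows "x y = twist_solution p \<rho> \<sigma> y"
proof -
  have T: "x (Fe k) - x (Fe (k + 1)) + x (Ff0 k) = \<rho> (TT k)" "x (Ff0 k) - x (Ff0 (k - 1)) = \<sigma> (TT k)"
    if "k \<in> {1..p}" for k
    using assms(1) that by (auto simp: twist_equations_def Let_def numeral_2_eq_2 numeral_3_eq_3)
  have U: "x Fr - x Fv + x Fs = \<rho> TU" "x Fs - x Fg = \<sigma> TU"
    and V: "x Fs - x Fg + x (Ff0 p) = \<rho> TV" "x (Ff0 p) - x Fu = \<sigma> TV"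
    and W: "x Fu - x Fv + x Fr = \<rho> TW" "x Fr - x (Fe (p + 1)) = \<sigma> TW"
    using assms(1) by (auto simp: twist_equations_def Let_def numeral_2_eq_2 numeral_3_eq_3)
  have f: "x (Ff0 k) = twist_solution p \<rho> \<sigma> (Ff0 k)" if "k \<le> p" for k
    using that
  proof (induction k rule: inc_induct)
    case base
    then show ?case using U V by (simp add: twist_solution_Ff0)
  next
    case (step k)
    have "{k + 1..p} = insert (k + 1) {k + 1 + 1..p}" using step.hyps by auto
    with step T(2)[of "Suc k"] show ?case by (simp add: twist_solution_Ff0)
  qed
  have e: "x (Fe k) = twist_solution p \<rho> \<sigma> (Fe k)" if "1 \<le> k" "k \<le> p + 1" for k
    using that
  proof (induction k rule: dec_induct)
    case base
    then show ?case using f[of 0] by (simp add: Ff0_def)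
  next
    case (step k)
    have "x (Fe (k + 1)) = x (Fe k) + x (Ff0 k) - \<rho> (TT k)"
      using T(1)[of k] step by simp
    also have "\<dots> = twist_solution p \<rho> \<sigma> (Fe k) + twist_solution p \<rho> \<sigma> (Ff0 k) - \<rho> (TT k)"
      using step f[of k] by simp
    also have "\<dots> = twist_solution p \<rho> \<sigma> (Fe (k + 1))"
      using twist_equations_solution[of p \<rho> \<sigma>] step
      by (force simp: twist_equations_def Let_def numeral_2_eq_2 numeral_3_eq_3)
    finally show ?case by simp
  qed
  have "x Fu = twist_solution p \<rho> \<sigma> Fu" "x Fr = twist_solution p \<rho> \<sigma> Fr"
    "x Fv = twist_solution p \<rho> \<sigma> Fv" "x Fs = twist_solution p \<rho> \<sigma> Fs" "x Fg = twist_solution p \<rho> \<sigma> Fg"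
    using U V W f[of p] e[of "p + 1"] twist_equations_solution[of p \<rho> \<sigma>]
    by (auto simp: twist_equations_def Let_def numeral_2_eq_2 numeral_3_eq_3)
  moreover have "x (Ff k) = twist_solution p \<rho> \<sigma> (Ff k)" if "k \<in> {1..p}" for k
    using f[of k] that by (simp add: Ff0_def)
  ultimately show ?thesis using e assms(2) by (auto simp: twist_faces_def)
qed

locale twist_knot =
  fixes n p :: nat
  assumes p_def: "p = (n - 2) div 2"
begin

lemma twist_tets: "set (tets (twist_triangulation n)) = TT ` {1..p} \<union> {TU, TV, TW}"
  "distinct (tets (twist_triangulation n))" "length (tets (twist_triangulation n)) = p + 3"
  by (auto simp: twist_triangulation_def Let_def p_def[symmetric] distinct_map inj_on_def)

lemma twist_faces_list: "set (faces (twist_triangulation n)) = twist_faces p"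
  "distinct (faces (twist_triangulation n))" "length (faces (twist_triangulation n)) = 2 * (p + 3)"
  by (auto simp: twist_triangulation_def Let_def p_def[symmetric] distinct_map inj_on_def twist_faces_def)

lemma twist_opp_face: "opp_face (twist_triangulation n) S k = twist_tet_faces p S ! k"
  by (simp add: twist_triangulation_def Let_def p_def[symmetric])

lemma twist_opp_face_in:
  assumes "S \<in> TT ` {1..p} \<union> {TU, TV, TW}" "k \<le> 3"
  shows "opp_face (twist_triangulation n) S k \<in> twist_faces p"
proof -
  have "k \<in> {0,1,2,3}" using assms(2) by auto
  moreover have "Ff0 j \<in> twist_faces p" if "j \<le> p" for j
    using that by (auto simp: Ff0_def twist_faces_def)
  moreover have "Fe j \<in> twist_faces p" if "1 \<le> j" "j \<le> p + 1" for j
    using that by (auto simp: twist_faces_def)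
  moreover have "{Fv, Fr, Fs, Fg, Fu} \<subseteq> twist_faces p" by (simp add: twist_faces_def)
  ultimately show ?thesis
    using assms(1) by (auto simp: twist_opp_face numeral_2_eq_2 numeral_3_eq_3)
qed

definition delta_target :: "nat \<Rightarrow> (twist_tet \<Rightarrow> real) \<Rightarrow> (twist_tet \<Rightarrow> real) \<Rightarrow> real" where
  "delta_target i \<rho> \<sigma> = (if even i then \<rho> else \<sigma>) (tets (twist_triangulation n) ! (i div 2))"

lemma delta_target_iff:
  "(\<forall>i < 2 * length (tets (twist_triangulation n)). delta_arg (twist_triangulation n) i x t = delta_target i \<rho> \<sigma>)
   \<longleftrightarrow> twist_equations p x \<rho> (\<lambda>S. \<sigma> S - t S)"
  (is "?L \<longleftrightarrow> ?R")
proof -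
  let ?X = "twist_triangulation n"
  define P where "P S \<longleftrightarrow> (let F = twist_tet_faces p S in
      x (F ! 0) - x (F ! 1) + x (F ! 2) = \<rho> S \<and> x (F ! 2) - x (F ! 3) = \<sigma> S - t S)" for S
  have "?L \<longleftrightarrow> (\<forall>j<length (tets ?X). P (tets ?X ! j))"
  proof (intro iffI allI impI)
    fix j assume L: ?L and j: "j < length (tets ?X)"
    show "P (tets ?X ! j)"
      using L[rule_format, of "2 * j"] L[rule_format, of "2 * j + 1"] j
      by (simp add: delta_arg_def twist_opp_face P_def delta_target_def Let_def)
  next
    fix i assume R: "\<forall>j<length (tets ?X). P (tets ?X ! j)" and i: "i < 2 * length (tets ?X)"
    then have "P (tets ?X ! (i div 2))" by simp
    then show "delta_arg ?X i x t = delta_target i \<rho> \<sigma>"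
      by (simp add: delta_arg_def twist_opp_face P_def delta_target_def Let_def)
  qed
  also have "\<dots> \<longleftrightarrow> ?R"
    unfolding all_set_conv_all_nth[symmetric] twist_tets(1) by (simp only: twist_equations_def P_def[abs_def])
  finally show ?thesis .
qed

lemma abs_det_twist_face_matrix: "\<bar>Determinant.det (face_matrix (twist_triangulation n))\<bar> = 1"
proof (rule abs_det_eq_1)
  let ?X = "twist_triangulation n"
  define m where "m = 2 * (p + 3)"
  have dims: "2 * length (tets ?X) = m" "length (faces ?X) = m"
    by (simp_all add: twist_tets twist_faces_list m_def)
  show "face_matrix ?X \<in> carrier_mat m m" by (simp add: face_matrix_def dims)
  show "face_matrix ?X $$ (i, j) \<in> \<int>" if "i < m" "j < m" for i j
    using that by (auto simp: face_matrix_def dims delta_arg_def Let_def)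
  fix k assume k: "k < m"
  define \<rho> where "\<rho> S = (of_bool (even k \<and> S = tets ?X ! (k div 2)) :: real)" for S
  define \<sigma> where "\<sigma> S = (of_bool (odd k \<and> S = tets ?X ! (k div 2)) :: real)" for S
  have rhs: "delta_target i \<rho> \<sigma> = of_bool (i = k)" if "i < m" for i
  proof -
    have "tets ?X ! (i div 2) = tets ?X ! (k div 2) \<longleftrightarrow> i div 2 = k div 2"
      using that k twist_tets(2) dims by (intro nth_eq_iff_index_eq) auto
    moreover have "i = k \<longleftrightarrow> i div 2 = k div 2 \<and> (even i \<longleftrightarrow> even k)"
      by (metis div_mult_mod_eq parity_cases mod_2_eq_odd odd_iff_mod_2_eq_one even_iff_mod_2_eq_zero)
    ultimately show ?thesis by (auto simp: delta_target_def \<rho>_def \<sigma>_def)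
  qed
  define x where "x = twist_solution p \<rho> \<sigma>"
  have rhs_int: "\<rho> S \<in> \<int>" "\<sigma> S \<in> \<int>" for S by (simp_all add: \<rho>_def \<sigma>_def)
  have int: "x y \<in> \<int>" for y
    unfolding x_def twist_solution_def Let_def
    by (cases y; simp only: twist_face.case; intro Ints_add Ints_diff Ints_sum rhs_int)
  have "twist_equations p x \<rho> (\<lambda>S. \<sigma> S - 0)"
    using twist_equations_solution by (simp add: x_def)
  then have *: "\<forall>i < 2 * length (tets ?X). delta_arg ?X i x (\<lambda>_. 0) = delta_target i \<rho> \<sigma>"
    by (simp only: delta_target_iff)
  have "(\<Sum>j<m. face_matrix ?X $$ (i, j) * x (faces ?X ! j)) = of_bool (i = k)"
    if i: "i < m" for i
  proof -
    have "(\<Sum>j<length (faces ?X). face_matrix ?X $$ (i, j) * x (faces ?X ! j)) = delta_arg ?X i x (\<lambda>_. 0)"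
      by (rule face_matrix_mult_vec[OF twist_faces_list(2)])
         (use i dims(1) twist_opp_face_in[folded twist_tets(1) twist_faces_list(1)] in auto)
    also have "\<dots> = delta_target i \<rho> \<sigma>" using * i dims(1) by simp
    finally show ?thesis unfolding dims(2) rhs[OF i] .
  qed
  then show "\<exists>x. (\<forall>j<m. x j \<in> \<int>) \<and> (\<forall>i<m. (\<Sum>j<m. face_matrix ?X $$ (i, j) * x j) = of_bool (i = k))"
    using int by (intro exI[of _ "\<lambda>j. x (faces ?X ! j)"]) simp
qed

lemma delta_solution_twist:
  assumes "y \<in> twist_faces p"
  shows "delta_solution (twist_triangulation n) t y = twist_solution p (\<lambda>_. 0) (\<lambda>S. - t S) y"
proof -
  let ?X = "twist_triangulation n"
  have iff: "(\<forall>i < 2 * length (tets ?X). delta_arg ?X i x t = 0) \<longleftrightarrow> twist_equations p x (\<lambda>_. 0) (\<lambda>S. - t S)" for x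
    using delta_target_iff[of x t "\<lambda>_. 0" "\<lambda>_. 0"] by (simp add: delta_target_def)
  define x0 where "x0 = restrict (twist_solution p (\<lambda>_. 0) (\<lambda>S. - t S)) (twist_faces p)"
  have "delta_solution ?X t = x0"
    unfolding delta_solution_def iff twist_faces_list(1)
  proof (rule the_equality)
    have cong: "twist_equations p x \<rho> \<sigma> \<longleftrightarrow> twist_equations p x' \<rho> \<sigma>"
      if "\<And>y. y \<in> twist_faces p \<Longrightarrow> x y = x' y" for x x' \<rho> \<sigma>
      using that twist_opp_face_in by (auto simp: twist_equations_def Let_def twist_opp_face)
    show "x0 \<in> extensional (twist_faces p) \<and> twist_equations p x0 (\<lambda>_. 0) (\<lambda>S. - t S)"
      using cong[of x0] twist_equations_solution by (simp add: x0_def)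
    show "x = x0" if "x \<in> extensional (twist_faces p) \<and> twist_equations p x (\<lambda>_. 0) (\<lambda>S. - t S)" for x
      using that twist_equations_unique[of p x]
      by (intro extensionalityI[of _ "twist_faces p"]) (auto simp: x0_def)
  qed
  then show ?thesis using assms by (simp add: x0_def)
qed

end

section \<open>The edges and the angle equations\<close>

text \<open>
  A numbering of the edges of the glued triangulation by \<open>0, ..., p + 2\<close>; it is chosen so that all gluings
  respect it, and it is uniform in \<open>p \<ge> 0\<close> although for \<open>p = 0\<close> the labels \<open>0\<close> and \<open>p\<close> coincide, as do the edges.
\<close>

fun edge_label :: "nat \<Rightarrow> twist_tet \<times> nat \<times> nat \<Rightarrow> nat" where
  "edge_label p (TT k, i, j) =
     (if (i, j) = (0, 1) \<or> (i, j) = (2, 3) then 0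
      else if (i, j) = (1, 2) then k - 1 else if (i, j) = (0, 3) then k + 1 else k)"
| "edge_label p (TU, i, j) =
     (if (i, j) = (0, 1) \<or> (i, j) = (2, 3) then p + 2 else if (i, j) = (0, 2) then p + 1 else p)"
| "edge_label p (TV, i, j) =
     (if (i, j) = (0, 1) then 0 else if (i, j) = (0, 2) \<or> (i, j) = (1, 2) then p + 2
      else if (i, j) = (0, 3) then p + 1 else p)"
| "edge_label p (TW, i, j) =
     (if (i, j) = (1, 2) then 0 else if (i, j) = (1, 3) \<or> (i, j) = (2, 3) then p + 2
      else if (i, j) = (0, 2) then p + 1 else p)"

text \<open>
  The labels of the edges \<open>01\<close>, \<open>02\<close>, \<open>12\<close> of a glued face, its vertices being numbered \<open>0, 1, 2\<close> in increasing
  order.  That a label depends only on the glued face and the position in it is what makes the labelling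
  invariant under gluing.
\<close>

fun face_edge_labels :: "nat \<Rightarrow> twist_face \<Rightarrow> nat \<times> nat \<times> nat" where
  "face_edge_labels p (Fe k) = (k - 1, k, 0)"
| "face_edge_labels p (Ff k) = (0, k + 1, k)"
| "face_edge_labels p Fv = (p + 1, p, p + 2)"
| "face_edge_labels p Fr = (p, p, p + 2)"
| "face_edge_labels p Fs = (p + 2, p, p)"
| "face_edge_labels p Fg = (p + 2, p + 1, p)"
| "face_edge_labels p Fu = (0, p + 2, p + 2)"

lemma face_edge_labels_Ff0: "face_edge_labels p (Ff0 k) = (0, k + 1, k)"
  by (simp add: Ff0_def)

lemma edge_label_face:
  assumes "S \<in> TT ` {1..p} \<union> {TU, TV, TW}" "k \<le> 3" "m < l" "l \<le> 2"
  shows "edge_label p (S, face_vertex k m, face_vertex k l) =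
    (case face_edge_labels p (twist_tet_faces p S ! k) of (x, y, z) \<Rightarrow>
       if (m, l) = (0, 1) then x else if (m, l) = (0, 2) then y else z)"
proof -
  have k: "k = 0 \<or> k = 1 \<or> k = 2 \<or> k = 3" using assms(2) by auto
  have ml: "(m = 0 \<and> l = 1) \<or> (m = 0 \<and> l = 2) \<or> (m = 1 \<and> l = 2)" using assms(3,4) by auto
  from assms(1) have S: "(\<exists>j. S = TT j \<and> 1 \<le> j) \<or> S = TU \<or> S = TV \<or> S = TW" by auto
  show ?thesis
    using S k ml
    by (elim disjE exE conjE; hypsubst)
       (simp_all add: face_vertex_def face_edge_labels_Ff0 numeral_2_eq_2 numeral_3_eq_3)
qed

context twist_knot
begin

lemma mem_tet_edges_twist:
  "(S, i, j) \<in> tet_edges (twist_triangulation n) \<longleftrightarrow> S \<in> TT ` {1..p} \<union> {TU, TV, TW} \<and> i < j \<and> j \<le> 3"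
  by (simp add: tet_edges_def twist_tets(1))

lemma edge_glueI:
  assumes "twist_tet_faces p S ! k = twist_tet_faces p S' ! k'"
    "S \<in> TT ` {1..p} \<union> {TU, TV, TW}" "S' \<in> TT ` {1..p} \<union> {TU, TV, TW}"
    "k \<le> 3" "k' \<le> 3" "m < l" "l \<le> 2"
  shows "((S, face_vertex k m, face_vertex k l), (S', face_vertex k' m, face_vertex k' l))
    \<in> edge_glue (twist_triangulation n)"
  using assms unfolding edge_glue_def twist_opp_face twist_tets(1) by blast

lemma edge_glue_label:
  assumes "(e, e') \<in> edge_glue (twist_triangulation n)"
  shows "edge_label p e' = edge_label p e \<and> e' \<in> tet_edges (twist_triangulation n)"
proof -
  from assms obtain S S' k k' m l where *:
    "e = (S, face_vertex k m, face_vertex k l)" "e' = (S', face_vertex k' m, face_vertex k' l)"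
    "S \<in> TT ` {1..p} \<union> {TU, TV, TW}" "S' \<in> TT ` {1..p} \<union> {TU, TV, TW}" "k \<le> 3" "k' \<le> 3"
    "twist_tet_faces p S ! k = twist_tet_faces p S' ! k'" "m < l" "l \<le> 2"
    unfolding edge_glue_def twist_opp_face twist_tets(1) by blast
  then have "edge_label p e' = edge_label p e"
    by (simp only: edge_label_face)
  moreover have "face_vertex k' m < face_vertex k' l" "face_vertex k' l \<le> 3"
    using * by (auto simp: face_vertex_def)
  ultimately show ?thesis using * by (simp add: mem_tet_edges_twist)
qed

text \<open>
  Invariance of the label bounds an edge class from above, explicit gluings bound it from below; if the two
  bounds agree, the class is known.
\<close>

lemma edge_class_eqI:
  assumes e: "e \<in> tet_edges (twist_triangulation n)"
    and conn: "\<And>e'. e' \<in> C \<Longrightarrow> (e, e') \<in> (edge_glue (twist_triangulation n))\<^sup>*"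
    and sup: "\<And>e'. e' \<in> tet_edges (twist_triangulation n) \<Longrightarrow> edge_label p e' = edge_label p e \<Longrightarrow> e' \<in> C"
  shows "C \<in> edge_classes (twist_triangulation n)"
proof -
  have "edge_label p e' = edge_label p e \<and> e' \<in> tet_edges (twist_triangulation n)"
    if "(e, e') \<in> (edge_glue (twist_triangulation n))\<^sup>*" for e'
    using that by induction (use e edge_glue_label in auto)
  then have "e' \<in> (edge_glue (twist_triangulation n))\<^sup>* `` {e} \<longleftrightarrow> e' \<in> C" for e'
    using conn[of e'] sup[of e'] by (metis Image_singleton_iff)
  then have "(edge_glue (twist_triangulation n))\<^sup>* `` {e} = C"
    by blast
  moreover have "(edge_glue (twist_triangulation n))\<^sup>* `` {e} \<in> edge_classes (twist_triangulation n)"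
    unfolding edge_classes_def using e by (rule quotientI)
  ultimately show ?thesis by simp
qed

lemma tet_edges_twist_cases:
  assumes "e \<in> tet_edges (twist_triangulation n)"
  obtains S i j where "e = (S, i, j)" "(\<exists>k. S = TT k \<and> 1 \<le> k \<and> k \<le> p) \<or> S = TU \<or> S = TV \<or> S = TW"
    "(i = 0 \<and> j = 1) \<or> (i = 0 \<and> j = 2) \<or> (i = 0 \<and> j = 3) \<or> (i = 1 \<and> j = 2) \<or> (i = 1 \<and> j = 3) \<or> (i = 2 \<and> j = 3)"
proof -
  obtain S i j where e: "e = (S, i, j)" by (cases e)
  then have "S \<in> TT ` {1..p} \<union> {TU, TV, TW}" and ij: "i < j" "j \<le> 3"
    using assms by (simp_all only: mem_tet_edges_twist)
  then have "(\<exists>k. S = TT k \<and> 1 \<le> k \<and> k \<le> p) \<or> S = TU \<or> S = TV \<or> S = TW" by auto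
  moreover have "(i = 0 \<and> j = 1) \<or> (i = 0 \<and> j = 2) \<or> (i = 0 \<and> j = 3) \<or> (i = 1 \<and> j = 2) \<or> (i = 1 \<and> j = 3) \<or> (i = 2 \<and> j = 3)"
    using ij by linarith
  ultimately show ?thesis using that e by blast
qed

lemma edge_class_label_p_plus_2: "{(TU, 0, 1), (TU, 2, 3), (TV, 0, 2), (TV, 1, 2), (TW, 1, 3), (TW, 2, 3)}
    \<in> edge_classes (twist_triangulation n)" (is "?C \<in> edge_classes ?X")
proof (rule edge_class_eqI[of "(TU, 0, 1)"])
  let ?R = "edge_glue (twist_triangulation n)"
  have 1: "((TU, 0, 1), (TV, 1, 2)) \<in> ?R"
    using edge_glueI[of TU 2 TV 0 0 1] by (simp add: face_vertex_def numeral_2_eq_2)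
  have 2: "((TU, 0, 1), (TV, 0, 2)) \<in> ?R"
    using edge_glueI[of TU 3 TV 1 0 1] by (simp add: face_vertex_def numeral_2_eq_2 numeral_3_eq_3)
  have 3: "((TV, 1, 2), (TW, 2, 3)) \<in> ?R"
    using edge_glueI[of TV 3 TW 0 1 2] by (simp add: face_vertex_def numeral_2_eq_2 numeral_3_eq_3)
  have 4: "((TV, 0, 2), (TW, 1, 3)) \<in> ?R"
    using edge_glueI[of TV 3 TW 0 0 2] by (simp add: face_vertex_def numeral_2_eq_2 numeral_3_eq_3)
  have 5: "((TW, 2, 3), (TU, 2, 3)) \<in> ?R"
    using edge_glueI[of TW 1 TU 1 1 2] by (simp add: face_vertex_def numeral_2_eq_2 numeral_3_eq_3)
  fix e' assume "e' \<in> ?C"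
  then show "((TU, 0, 1), e') \<in> ?R\<^sup>*"
    using 1 2 3 4 5 by (auto intro: converse_rtrancl_into_rtrancl)
next
  fix e' assume *: "e' \<in> tet_edges ?X" "edge_label p e' = edge_label p (TU, 0, 1)"
  from *(1) *(2) show "e' \<in> ?C"
    by (elim tet_edges_twist_cases disjE exE conjE; hypsubst; auto split: if_splits)
qed (simp add: mem_tet_edges_twist)

lemma edge_class_label_p_plus_1: "{(TU, 0, 2), (TV, 0, 3), (TW, 0, 2)} \<union> {(TT k, 0, 3) |k. k = p \<and> 1 \<le> p}
    \<in> edge_classes (twist_triangulation n)" (is "?C \<in> edge_classes ?X")
proof (rule edge_class_eqI[of "(TU, 0, 2)"])
  let ?R = "edge_glue (twist_triangulation n)"
  have 1: "((TU, 0, 2), (TW, 0, 2)) \<in> ?R"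
    using edge_glueI[of TU 1 TW 1 0 1] by (simp add: face_vertex_def numeral_2_eq_2)
  have 2: "((TU, 0, 2), (TV, 0, 3)) \<in> ?R"
    using edge_glueI[of TU 3 TV 1 0 2] by (simp add: face_vertex_def numeral_2_eq_2 numeral_3_eq_3)
  have 3: "((TV, 0, 3), (TT p, 0, 3)) \<in> ?R" if "1 \<le> p"
    using edge_glueI[of TV 2 "TT p" 2 0 2] that by (simp add: face_vertex_def numeral_2_eq_2 numeral_3_eq_3)
  fix e' assume "e' \<in> ?C"
  then show "((TU, 0, 2), e') \<in> ?R\<^sup>*"
    using 1 2 3 by (auto intro: converse_rtrancl_into_rtrancl)
next
  fix e' assume *: "e' \<in> tet_edges ?X" "edge_label p e' = edge_label p (TU, 0, 2)"
  from *(1) *(2) show "e' \<in> ?C"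
    by (elim tet_edges_twist_cases disjE exE conjE; hypsubst; auto split: if_splits)
qed (simp add: mem_tet_edges_twist)

lemma edge_class_label_inner:
  assumes q: "1 \<le> q" "q < p"
  shows "{(TT q, 0, 2), (TT q, 1, 3), (TT (q + 1), 1, 2)} \<union> {(TT k, 0, 3) |k. k + 1 = q \<and> 1 \<le> k}
    \<in> edge_classes (twist_triangulation n)" (is "?C \<in> edge_classes ?X")
proof (rule edge_class_eqI[of "(TT q, 0, 2)"])
  let ?R = "edge_glue (twist_triangulation n)"
  have 1: "((TT q, 0, 2), (TT (q + 1), 1, 2)) \<in> ?R"
    using edge_glueI[of "TT q" 1 "TT (q + 1)" 0 0 1] q by (simp add: face_vertex_def numeral_2_eq_2)
  have 2: "((TT (q + 1), 1, 2), (TT q, 1, 3)) \<in> ?R"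
    using edge_glueI[of "TT (q + 1)" 3 "TT q" 2 1 2] q by (simp add: face_vertex_def numeral_2_eq_2 numeral_3_eq_3)
  have 3: "((TT (k + 1), 0, 2), (TT k, 0, 3)) \<in> ?R" if "1 \<le> k" "k + 1 = q" for k
    using edge_glueI[of "TT (k + 1)" 3 "TT k" 2 0 2] that q by (simp add: face_vertex_def numeral_2_eq_2 numeral_3_eq_3)
  fix e' assume "e' \<in> ?C"
  then show "((TT q, 0, 2), e') \<in> ?R\<^sup>*"
    using 1 2 3 by (auto intro: converse_rtrancl_into_rtrancl)
next
  fix e' assume *: "e' \<in> tet_edges ?X" "edge_label p e' = edge_label p (TT q, 0, 2)"
  from *(1) *(2) q show "e' \<in> ?C"
    by (elim tet_edges_twist_cases disjE exE conjE; hypsubst; auto split: if_splits)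
qed (use q in \<open>simp add: mem_tet_edges_twist\<close>)

lemma edge_class_label_0:
  assumes p: "1 \<le> p"
  shows "(\<lambda>k. (TT k, 0, 1)) ` {1..p} \<union> (\<lambda>k. (TT k, 2, 3)) ` {1..p} \<union> {(TT 1, 1, 2), (TV, 0, 1), (TW, 1, 2)}
    \<in> edge_classes (twist_triangulation n)" (is "?C \<in> edge_classes ?X")
proof (rule edge_class_eqI[of "(TV, 0, 1)"])
  let ?R = "edge_glue (twist_triangulation n)"
  have 1: "((TV, 0, 1), (TW, 1, 2)) \<in> ?R"
    using edge_glueI[of TV 3 TW 0 0 1] by (simp add: face_vertex_def numeral_2_eq_2 numeral_3_eq_3)
  have 2: "((TV, 0, 1), (TT p, 0, 1)) \<in> ?R"
    using edge_glueI[of TV 2 "TT p" 2 0 1] p by (simp add: face_vertex_def numeral_2_eq_2)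
  have 3: "((TW, 1, 2), (TT p, 2, 3)) \<in> ?R"
    using edge_glueI[of TW 3 "TT p" 1 1 2] p by (simp add: face_vertex_def numeral_2_eq_2 numeral_3_eq_3)
  have 4: "((TT 1, 0, 1), (TT 1, 1, 2)) \<in> ?R"
    using edge_glueI[of "TT 1" 3 "TT 1" 0 0 1] p by (simp add: face_vertex_def numeral_2_eq_2 numeral_3_eq_3 Ff0_def)
  have 5: "((TT (Suc k), 0, 1), (TT k, 0, 1)) \<in> ?R" "((TT (Suc k), 2, 3), (TT k, 2, 3)) \<in> ?R"
    if "1 \<le> k" "k < p" for k
    using edge_glueI[of "TT (k + 1)" 3 "TT k" 2 0 1] edge_glueI[of "TT (k + 1)" 0 "TT k" 1 1 2] that
    by (simp_all add: face_vertex_def numeral_2_eq_2 numeral_3_eq_3)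
  have 6: "((TV, 0, 1), (TT k, 0, 1)) \<in> ?R\<^sup>*" "((TV, 0, 1), (TT k, 2, 3)) \<in> ?R\<^sup>*"
    if k: "k \<le> p" "1 \<le> k" for k
    using k(1)
  proof (induction k rule: inc_induct)
    case base
    show "((TV, 0, 1), (TT p, 0, 1)) \<in> ?R\<^sup>*" "((TV, 0, 1), (TT p, 2, 3)) \<in> ?R\<^sup>*"
      using 1 2 3 by (auto intro: converse_rtrancl_into_rtrancl)
  next
    case (step m)
    then have "((TT (Suc m), 0, 1), (TT m, 0, 1)) \<in> ?R" "((TT (Suc m), 2, 3), (TT m, 2, 3)) \<in> ?R"
      using 5[of m] k(2) by auto
    with step.IH show "((TV, 0, 1), (TT m, 0, 1)) \<in> ?R\<^sup>*" "((TV, 0, 1), (TT m, 2, 3)) \<in> ?R\<^sup>*"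
      by (blast intro: rtrancl_into_rtrancl)+
  qed
  have 7: "((TV, 0, 1), (TT 1, 1, 2)) \<in> ?R\<^sup>*"
    using 6(1)[of 1] 4 p by (auto intro: rtrancl_into_rtrancl)
  fix e' assume "e' \<in> ?C"
  then show "((TV, 0, 1), e') \<in> ?R\<^sup>*"
    using 1 6 7 by auto
next
  fix e' assume *: "e' \<in> tet_edges ?X" "edge_label p e' = edge_label p (TV, 0, 1)"
  from *(1) *(2) p show "e' \<in> ?C"
    by (elim tet_edges_twist_cases disjE exE conjE; hypsubst; auto split: if_splits)
qed (simp add: mem_tet_edges_twist)

end

locale twist_angle_structure = twist_knot +
  fixes a b c :: "twist_tet \<Rightarrow> real"
  assumes ang: "(a, b, c) \<in> angle_structures (twist_triangulation n)"
begin

lemma tet_angles: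
  assumes "S \<in> TT ` {1..p} \<union> {TU, TV, TW}"
  shows "0 < a S" "0 < b S" "0 < c S" "a S + b S + c S = pi"
  using ang assms by (auto simp: angle_structures_def twist_tets(1))

lemma edge_class_sum: "C \<in> edge_classes (twist_triangulation n) \<Longrightarrow> (\<Sum>e\<in>C. edge_angle (a, b, c) e) = 2 * pi"
  using ang by (auto simp: angle_structures_def)

lemma angle_sum_label_p_plus_2: "2 * a TU + b TV + c TV + b TW + a TW = 2 * pi"
  using edge_class_sum[OF edge_class_label_p_plus_2] by (simp add: doubleton_eq_iff)

lemma angle_sum_label_p_plus_1: "b TU + c TV + b TW + (if p = 0 then 0 else c (TT p)) = 2 * pi"
  using edge_class_sum[OF edge_class_label_p_plus_1] by (cases "p = 0") (simp_all add: doubleton_eq_iff)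

lemma angle_sum_label_inner:
  assumes "1 \<le> q" "q < p"
  shows "2 * b (TT q) + c (TT (q + 1)) + (if q = 1 then 0 else c (TT (q - 1))) = 2 * pi"
proof (cases "q = 1")
  case True
  then show ?thesis using edge_class_sum[OF edge_class_label_inner[OF assms]] by (simp add: doubleton_eq_iff)
next
  case False
  then have "{(TT k, 0, 3) |k. k + 1 = q \<and> 1 \<le> k} = {(TT (q - 1), 0, 3 :: nat)}"
    using assms by auto
  from edge_class_sum[OF edge_class_label_inner[OF assms], unfolded this] False assms show ?thesis
    by (simp add: doubleton_eq_iff)
qed

lemma angle_sum_label_0:
  assumes "1 \<le> p"
  shows "2 * (\<Sum>k=1..p. a (TT k)) + c (TT 1) + a TV + c TW = 2 * pi"
proof -
  have "(\<Sum>e\<in>(\<lambda>k. (TT k, 0, 1)) ` {1..p} \<union> (\<lambda>k. (TT k, 2, 3)) ` {1..p} \<union>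
      {(TT 1, 1, 2), (TV, 0, 1), (TW, 1, 2)}. edge_angle (a, b, c) e)
    = (\<Sum>e\<in>(\<lambda>k. (TT k, 0, 1)) ` {1..p}. edge_angle (a, b, c) e)
    + (\<Sum>e\<in>(\<lambda>k. (TT k, 2, 3)) ` {1..p}. edge_angle (a, b, c) e)
    + (\<Sum>e\<in>{(TT 1, 1, 2), (TV, 0, 1), (TW, 1, 2)}. edge_angle (a, b, c) e)"
    by (subst sum.union_disjoint; (subst sum.union_disjoint)?) auto
  also have "\<dots> = (\<Sum>k=1..p. a (TT k)) + (\<Sum>k=1..p. a (TT k)) + (c (TT 1) + a TV + c TW)"
    by (simp add: sum.reindex inj_on_def doubleton_eq_iff)
  finally show ?thesis using edge_class_sum[OF edge_class_label_0[OF assms]] by simp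
qed

lemma angle_relation_W: "c TW = 2 * a TU - a TV"
  using angle_sum_label_p_plus_2 tet_angles(4)[of TV] tet_angles(4)[of TW] by simp

text \<open>
  The left-hand side minus the right-hand side, as a function of \<open>k\<close> starting at \<open>k = 0\<close> with value \<open>0\<close>, has vanishing second
  difference: \<open>min j k\<close> has second difference \<open>- 1\<close> at \<open>k = j\<close> and \<open>0\<close> elsewhere, which leaves the angle
  equation of the edge with label \<open>k\<close>.  The value at \<open>k = 1\<close> is the equation of the edge with label \<open>0\<close>.
\<close>

lemma angle_relation_T:
  assumes "k \<in> {1..p}"
  shows "2 * (\<Sum>j=1..p. real (min j k) * a (TT j)) + 2 * real k * a TU + c (TT k) = 2 * pi * real k"
proof -
  define L where "L k = 2 * (\<Sum>j=1..p. real (min j k) * a (TT j)) + 2 * real k * a TU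
     + (if k = 0 then 0 else c (TT k)) - 2 * pi * real k" for k
  \<comment> \<open>The case distinction implements the convention \<open>c (TT 0) = 0\<close>, with which \<open>L 0 = 0\<close>.\<close>
  have L1: "L 1 = 0"
  proof -
    have "(\<Sum>j=1..p. real (min j 1) * a (TT j)) = (\<Sum>j=1..p. a (TT j))"
      by (intro sum.cong) (auto simp: min_def)
    then show ?thesis using angle_sum_label_0 assms angle_relation_W by (simp add: L_def)
  qed
  have step: "L (k + 2) = 2 * L (k + 1) - L k" if "k + 2 \<le> p" for k
  proof -
    have "(\<Sum>j=1..p. real (min j (k + 2)) * a (TT j)) - 2 * (\<Sum>j=1..p. real (min j (k + 1)) * a (TT j))
        + (\<Sum>j=1..p. real (min j k) * a (TT j))
      = (\<Sum>j=1..p. (real (min j (k + 2)) - 2 * real (min j (k + 1)) + real (min j k)) * a (TT j))"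
      by (simp add: sum.distrib sum_subtractf sum_distrib_left algebra_simps)
    also have "\<dots> = (\<Sum>j=1..p. if j = k + 1 then - a (TT (k + 1)) else 0)"
      by (intro sum.cong) (auto simp: min_def)
    also have "\<dots> = - a (TT (k + 1))" using that by simp
    finally have "L (k + 2) - 2 * L (k + 1) + L k = - 2 * a (TT (k + 1)) + c (TT (k + 2)) - 2 * c (TT (k + 1))
        + (if k = 0 then 0 else c (TT k))"
      by (simp add: L_def algebra_simps)
    also have "\<dots> = 0"
      using angle_sum_label_inner[of "k + 1"] tet_angles(4)[of "TT (k + 1)"] that by (simp split: if_splits)
    finally show ?thesis by simp
  qed
  have "L 0 = 0" by (simp add: L_def)
  then have "k \<le> p \<Longrightarrow> L k = 0" for k
    by (induction k rule: induct_nat_012) (use L1 step in auto)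
  from this[of k] assms show ?thesis by (simp add: L_def split: if_splits)
qed

text \<open>
  Add the relation for \<open>T\<^sub>p\<close> (an empty statement if \<open>p = 0\<close>) to the equation of the edge with label \<open>p + 1\<close>,
  which is the one through which \<open>c (TT p)\<close> can be eliminated.
\<close>

lemma angle_relation_U:
  "2 * (\<Sum>j=1..p. real j * a (TT j)) + 2 * (real p + 1) * a TU + a TW + a TU - a TV + c TU - c TV
   = 2 * real p * pi"
proof -
  have "2 * (\<Sum>j=1..p. real j * a (TT j)) + 2 * real p * a TU + (if p = 0 then 0 else c (TT p)) = 2 * pi * real p"
  proof (cases "p = 0")
    case False
    have "(\<Sum>j=1..p. real (min j p) * a (TT j)) = (\<Sum>j=1..p. real j * a (TT j))"
      by (intro sum.cong) (auto simp: min_def)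
    then show ?thesis using angle_relation_T[of p] False by simp
  qed simp
  then show ?thesis
    using angle_sum_label_p_plus_1 angle_relation_W tet_angles(4)[of TU] tet_angles(4)[of TW]
    by (simp add: algebra_simps)
qed

end

section \<open>The quadratic form\<close>

lemma sum_twist_index:
  "(\<Sum>S\<in>twist_index p. g S) = (\<Sum>k=1..p. g (TT k)) + g TU + (g TW :: 'a :: comm_monoid_add)"
proof -
  have "(\<Sum>S\<in>twist_index p. g S) = sum g (TT ` {1..p}) + sum g {TU, TW}"
    unfolding twist_index_def by (rule sum.union_disjoint) auto
  then show ?thesis by (simp add: sum.reindex inj_on_def add.assoc)
qed

lemma prod_twist_tets:
  "(\<Prod>S\<in>TT ` {1..p} \<union> {TU, TV, TW}. g S) = (\<Prod>k=1..p. g (TT k)) * g TU * g TV * (g TW :: 'a :: comm_monoid_mult)"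
proof -
  have "(\<Prod>S\<in>TT ` {1..p} \<union> {TU, TV, TW}. g S) = prod g (TT ` {1..p}) * prod g {TU, TV, TW}"
    by (rule prod.union_disjoint) auto
  then show ?thesis by (simp add: prod.reindex inj_on_def mult.assoc)
qed

text \<open>
  The quadratic form of the exponent of the integrand of \<open>J\<close>, in the variables \<open>y'\<close> and \<open>x\<close>.  It is polymorphic
  because it occurs both at the real variables \<open>t\<close> and at complex points of the contours.
\<close>

definition twist_form :: "nat \<Rightarrow> (nat \<Rightarrow> 'a) \<Rightarrow> 'a \<Rightarrow> 'a \<Rightarrow> 'a \<Rightarrow> 'a :: comm_ring_1" where
  "twist_form p y yU yW x =
    (\<Sum>j=1..p. \<Sum>k=1..p. of_nat (min j k) * y j * y k) + 2 * yU * (\<Sum>k=1..p. of_nat k * y k)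
     + (of_nat p + 1) * yU * yU - yU * yW + x * (yU - yW - x)"

lemma of_real_twist_form:
  "of_real (twist_form p y yU yW x)
     = twist_form p (\<lambda>k. of_real (y k)) (of_real yU) (of_real yW) (of_real x :: complex)"
  by (simp add: twist_form_def)

lemma twist_form_Q:
  "(\<Sum>j\<in>twist_index p. \<Sum>k\<in>twist_index p. y j * complex_of_real (twist_Q p j k) * y k)
     + x * (y TU - y TW - x) = twist_form p (\<lambda>k. y (TT k)) (y TU) (y TW) x"
proof -
  have "(\<Sum>j\<in>twist_index p. \<Sum>k\<in>twist_index p. y j * complex_of_real (twist_Q p j k) * y k)
    = (\<Sum>j=1..p. (\<Sum>k=1..p. of_nat (min j k) * y (TT j) * y (TT k)) + of_nat j * y (TT j) * y TU)
     + ((\<Sum>k=1..p. of_nat k * y (TT k) * y TU) + (of_nat p + 1) * y TU * y TU - y TU * y TW / 2) - y TU * y TW / 2"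
    unfolding sum_twist_index by (simp add: mult_ac)
  also have "\<dots> = (\<Sum>j=1..p. \<Sum>k=1..p. of_nat (min j k) * y (TT j) * y (TT k))
     + 2 * y TU * (\<Sum>k=1..p. of_nat k * y (TT k)) + (of_nat p + 1) * y TU * y TU - y TU * y TW"
    by (simp add: sum.distrib sum_distrib_left sum_distrib_right algebra_simps)
  finally show ?thesis by (simp add: twist_form_def)
qed

text \<open>
  The second-order Taylor expansion; the coefficients of \<open>w\<close> are the partial derivatives of the form at
  \<open>\<eta>\<close>.  It will be used with \<open>w = - \<i>\<close>.
\<close>

lemma twist_form_shift:
  fixes w :: "'a :: comm_ring_1"
  shows "twist_form p (\<lambda>k. y k + w * \<eta> k) (yU + w * \<eta>U) (yW + w * \<eta>W) (x + w * \<eta>x)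
    = twist_form p y yU yW x
    + w * ((\<Sum>k=1..p. 2 * ((\<Sum>j=1..p. of_nat (min j k) * \<eta> j) + of_nat k * \<eta>U) * y k)
         + (2 * (\<Sum>j=1..p. of_nat j * \<eta> j) + 2 * (of_nat p + 1) * \<eta>U - \<eta>W + \<eta>x) * yU
         + (- \<eta>U - \<eta>x) * yW + (\<eta>U - \<eta>W - 2 * \<eta>x) * x)
    + w * w * twist_form p \<eta> \<eta>U \<eta>W \<eta>x"
proof -
  define A where "A = (\<Sum>k=1..p. (\<Sum>j=1..p. of_nat (min j k) * \<eta> j) * y k)"
  have A1: "(\<Sum>j=1..p. \<Sum>k=1..p. of_nat (min j k) * y k * \<eta> j) = A"
    unfolding A_def by (subst sum.swap) (simp add: sum_distrib_left sum_distrib_right mult_ac)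
  have A2: "(\<Sum>j=1..p. \<Sum>k=1..p. of_nat (min j k) * y j * \<eta> k) = A"
    unfolding A_def by (simp add: sum_distrib_left sum_distrib_right mult_ac min.commute)
  have "(\<Sum>j=1..p. \<Sum>k=1..p. of_nat (min j k) * (y j + w * \<eta> j) * (y k + w * \<eta> k))
    = (\<Sum>j=1..p. \<Sum>k=1..p. of_nat (min j k) * y j * y k + w * (of_nat (min j k) * y k * \<eta> j)
        + w * (of_nat (min j k) * y j * \<eta> k) + w * w * (of_nat (min j k) * \<eta> j * \<eta> k))"
    by (intro sum.cong refl) (simp add: algebra_simps)
  also have "\<dots> = (\<Sum>j=1..p. \<Sum>k=1..p. of_nat (min j k) * y j * y k) + w * A + w * A
      + w * w * (\<Sum>j=1..p. \<Sum>k=1..p. of_nat (min j k) * \<eta> j * \<eta> k)"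
    unfolding sum.distrib sum_distrib_left[symmetric] A1 A2 ..
  finally have 1: "(\<Sum>j=1..p. \<Sum>k=1..p. of_nat (min j k) * (y j + w * \<eta> j) * (y k + w * \<eta> k)) = \<dots>" .
  have 2: "(\<Sum>k=1..p. of_nat k * (y k + w * \<eta> k)) = (\<Sum>k=1..p. of_nat k * y k) + w * (\<Sum>k=1..p. of_nat k * \<eta> k)"
    by (simp add: distrib_left sum.distrib sum_distrib_left mult_ac)
  have 3: "(\<Sum>k=1..p. 2 * ((\<Sum>j=1..p. of_nat (min j k) * \<eta> j) + of_nat k * \<eta>U) * y k)
      = 2 * A + 2 * \<eta>U * (\<Sum>k=1..p. of_nat k * y k)"
    unfolding A_def by (simp add: distrib_left distrib_right sum.distrib sum_distrib_left mult_ac)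
  show ?thesis
    unfolding twist_form_def 1 2 3
    by (simp add: algebra_simps)
qed

context twist_knot
begin

lemma twist_solution_e:
  assumes "1 \<le> k" "k \<le> p + 1"
  shows "twist_solution p (\<lambda>_. 0) (\<lambda>S. - t S) (Fe k)
    = real k * t TU + (\<Sum>j=1..p. real (min j k) * t (TT j))"
  using assms
proof (induction k rule: dec_induct)
  case base
  have "(\<Sum>j=1..p. t (TT j)) = (\<Sum>j=1..p. real (min j 1) * t (TT j))"
    by (intro sum.cong) (auto simp: min_def)
  then show ?case by (simp add: twist_solution_def Let_def sum_negf)
next
  case (step k)
  have "{1..<Suc k} = insert k {1..<k}" using step by auto
  then have "twist_solution p (\<lambda>_. 0) (\<lambda>S. - t S) (Fe (Suc k))
      = twist_solution p (\<lambda>_. 0) (\<lambda>S. - t S) (Fe k) + (t TU + (\<Sum>j=k+1..p. t (TT j)))"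
    by (simp add: twist_solution_def Let_def sum_negf)
  also have "(\<Sum>j=k+1..p. t (TT j)) = (\<Sum>j=1..p. of_bool (k < j) * t (TT j))"
    by (rule sum.mono_neutral_cong_left) (use step in auto)
  also have "twist_solution p (\<lambda>_. 0) (\<lambda>S. - t S) (Fe k) = real k * t TU + (\<Sum>j=1..p. real (min j k) * t (TT j))"
    using step by simp
  also have "real k * t TU + (\<Sum>j=1..p. real (min j k) * t (TT j)) + (t TU + (\<Sum>j=1..p. of_bool (k < j) * t (TT j)))
    = real (Suc k) * t TU + (\<Sum>j=1..p. (real (min j k) + of_bool (k < j)) * t (TT j))"
    by (simp add: sum.distrib distrib_right)
  also have "(\<Sum>j=1..p. (real (min j k) + of_bool (k < j)) * t (TT j)) = (\<Sum>j=1..p. real (min j (Suc k)) * t (TT j))"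
    by (intro sum.cong) (auto simp: min_def)
  finally show ?case .
qed

text \<open>
  The faces opposite to vertex \<open>0\<close> are \<open>e\<^sub>k\<close> for \<open>T\<^sub>k\<close>, \<open>r\<close> for \<open>U\<close>, \<open>s\<close> for \<open>V\<close>, \<open>u\<close> for \<open>W\<close>.  Here
  \<open>e\<^sub>k = k t\<^sub>U + \<Sum>j. min j k t\<^sub>j\<close> explains the entries of \<open>Q\<close>, and \<open>s = u = t\<^sub>U + t\<^sub>V\<close> explains the role of \<open>x\<close>.
\<close>

lemma kinematical_kernel_twist:
  "kinematical_kernel (twist_triangulation n) t
    = exp (2 * \<i> * complex_of_real pi *
        complex_of_real (twist_form p (\<lambda>k. t (TT k)) (t TU) (t TW) (t TU + t TV)))"
proof -
  let ?X = "twist_triangulation n"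
  let ?x = "twist_solution p (\<lambda>_. 0) (\<lambda>S. - t S)"
  have det: "\<bar>Determinant.det (face_matrix ?X)\<bar> = 1"
    by (rule abs_det_twist_face_matrix)
  have sol: "delta_solution ?X t (opp_face ?X S 0) = ?x (twist_tet_faces p S ! 0)"
    if "S \<in> TT ` {1..p} \<union> {TU, TV, TW}" for S
    using delta_solution_twist[OF twist_opp_face_in[OF that, of 0]]
    by (simp add: twist_opp_face)
  have sgn: "tet_sign ?X = twist_sign" by (simp add: twist_triangulation_def Let_def)
  have fp: "(\<Sum>j=1..p. real (min j (p + 1)) * t (TT j)) = (\<Sum>j=1..p. real j * t (TT j))"
    by (intro sum.cong) (auto simp: min_def)
  have xr: "?x Fr = real (p + 1) * t TU + (\<Sum>j=1..p. real j * t (TT j)) - t TW"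
    using twist_solution_e[of "p + 1" t] unfolding fp
    by (simp add: twist_solution_def Let_def)
  have xu: "?x Fu = t TU + t TV" by (simp add: twist_solution_def Let_def)
  have xs: "?x Fs = t TU + t TV" by (simp add: twist_solution_def Let_def)
  have "(\<Sum>k=1..p. ?x (Fe k) * t (TT k))
      = (\<Sum>k=1..p. (real k * t TU + (\<Sum>j=1..p. real (min j k) * t (TT j))) * t (TT k))"
    by (intro sum.cong refl arg_cong2[of _ _ _ _ "(*)"] twist_solution_e) auto
  also have "\<dots> = t TU * (\<Sum>k=1..p. real k * t (TT k)) + (\<Sum>k=1..p. \<Sum>j=1..p. real (min k j) * t (TT k) * t (TT j))"
    by (simp add: algebra_simps sum.distrib sum_distrib_left min.commute)
  finally have xe: "(\<Sum>k=1..p. ?x (Fe k) * t (TT k)) = \<dots>" .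
  define P where "P = 2 * \<i> * complex_of_real pi"
  have "Determinant.det (face_matrix ?X) \<noteq> 0" using det by auto
  then have "kinematical_kernel ?X t = (\<Prod>S\<in>TT ` {1..p} \<union> {TU, TV, TW}.
      exp (2 * \<i> * complex_of_real (pi * of_int (twist_sign S) * delta_solution ?X t (opp_face ?X S 0) * t S)))"
    unfolding kinematical_kernel_def det sgn twist_tets(1) by simp
  also have "\<dots> = (\<Prod>S\<in>TT ` {1..p} \<union> {TU, TV, TW}.
      exp (2 * \<i> * complex_of_real (pi * of_int (twist_sign S) * ?x (twist_tet_faces p S ! 0) * t S)))"
    by (intro prod.cong refl) (simp only: sol)
  also have "\<dots> = (\<Prod>S\<in>TT ` {1..p} \<union> {TU, TV, TW}.
      exp (P * complex_of_real (of_int (twist_sign S) * ?x (twist_tet_faces p S ! 0) * t S)))"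
    by (simp add: P_def mult_ac)
  also have "\<dots> = exp (P * complex_of_real ((\<Sum>k=1..p. ?x (Fe k) * t (TT k)) + ?x Fr * t TU - ?x Fs * t TV - ?x Fu * t TW))"
    unfolding prod_twist_tets by (simp add: exp_sum[symmetric] exp_add[symmetric] sum_distrib_left algebra_simps)
  also have "(\<Sum>k=1..p. ?x (Fe k) * t (TT k)) + ?x Fr * t TU - ?x Fs * t TV - ?x Fu * t TW
      = twist_form p (\<lambda>k. t (TT k)) (t TU) (t TW) (t TU + t TV)"
    unfolding xe xr xs xu twist_form_def by (simp add: algebra_simps)
  finally show ?thesis by (simp add: P_def)
qed

end

section \<open>Matching the exponents\<close>

lemma sum_min:
  assumes "k \<le> p"
  shows "(\<Sum>j=1..p. real (min j k)) = real k * real p - real k * (real k - 1) / 2"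
  using assms
proof (induction p rule: dec_induct)
  case base
  have "(\<Sum>j=1..k. real (min j k)) = (\<Sum>j=1..k. real j)"
    by (intro sum.cong) auto
  also have "\<dots> = real k * (real k + 1) / 2" by (induction k) (auto simp: field_simps)
  finally show ?case by (simp add: field_simps)
next
  case (step m)
  then have "(\<Sum>j=1..Suc m. real (min j k)) = (\<Sum>j=1..m. real (min j k)) + real k" by simp
  with step.IH show ?case by (simp add: field_simps)
qed

lemma twist_height_simps:
  "twist_height \<b> a (TT k) = - (pi - a (TT k)) / (2 * pi * sqrt (hbar \<b>))"
  "twist_height \<b> a TU = - (pi - a TU) / (2 * pi * sqrt (hbar \<b>))"
  "twist_height \<b> a TW = (pi - a TW) / (2 * pi * sqrt (hbar \<b>))"
  by (simp_all add: twist_height_def)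

locale twist_partition_function = twist_angle_structure +
  fixes \<b> :: real
  assumes b_pos: "\<b> > 0"
begin

text \<open>
  The contour of \<open>x\<close> has height \<open>hx\<close>, and \<open>hV\<close> is the height at which the quantum dilogarithm of \<open>V\<close> is
  evaluated; the latter is the height of \<open>x - y'\<^sub>U\<close>.
\<close>

definition mu where "mu = a TU - a TV"
definition lam where "lam = 2 * (a TV - a TU + a TW - b TV)"
definition R where "R = 1 / sqrt (hbar \<b>)"
definition h where "h = twist_height \<b> a"
definition hV where "hV = (pi - a TV) * R / (2 * pi)"
definition hx where "hx = mu * R / (2 * pi)"

lemma contour_heights:
  "2 * pi * h (TT k) = - R * (pi - a (TT k))" "2 * pi * h TU = - R * (pi - a TU)"
  "2 * pi * h TW = R * (pi - a TW)" "2 * pi * hx = R * (a TU - a TV)" "2 * pi * hV = R * (pi - a TV)"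
  by (simp_all add: h_def twist_height_simps hx_def hV_def R_def mu_def) (simp_all add: diff_divide_distrib)

text \<open>
  This and the next three facts compare, for each variable, the derivative of the quadratic form at the
  contour heights plus the contribution of the terms \<open>c\<^sub>S t\<^sub>S\<close> with the coefficient wanted in the exponent of \<open>J\<close>.
  Every height is \<open>\<plusminus>R / (2 \<pi>)\<close> times an angle combination, so dividing by \<open>R\<close> gives an equation between angles.
\<close>

lemma linear_coefficient_T:
  assumes "k \<in> {1..p}"
  shows "2 * pi * (2 * ((\<Sum>j=1..p. real (min j k) * h (TT j)) + real k * h TU)) + R * c (TT k) = R * twist_W p (TT k)"
proof -
  have "2 * pi * (\<Sum>j=1..p. real (min j k) * h (TT j)) = (\<Sum>j=1..p. real (min j k) * (2 * pi * h (TT j)))"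
    by (simp add: sum_distrib_left mult_ac)
  also have "\<dots> = R * (\<Sum>j=1..p. real (min j k) * a (TT j)) - R * pi * (\<Sum>j=1..p. real (min j k))"
    unfolding contour_heights by (simp add: sum_distrib_left algebra_simps sum_subtractf)
  finally have 1: "2 * pi * (\<Sum>j=1..p. real (min j k) * h (TT j)) = \<dots>" .
  have "2 * pi * (2 * ((\<Sum>j=1..p. real (min j k) * h (TT j)) + real k * h TU)) + R * c (TT k)
    = 2 * (2 * pi * (\<Sum>j=1..p. real (min j k) * h (TT j))) + 2 * real k * (2 * pi * h TU) + R * c (TT k)"
    by (simp add: algebra_simps)
  also have "\<dots> = R * (2 * (\<Sum>j=1..p. real (min j k) * a (TT j)) + 2 * real k * a TU + c (TT k)
     - 2 * pi * real k - 2 * pi * (\<Sum>j=1..p. real (min j k)))"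
    unfolding 1 contour_heights by (simp add: algebra_simps)
  also have "\<dots> = R * twist_W p (TT k)"
    using angle_relation_T[OF assms] sum_min[of k p] assms by simp
  finally show ?thesis .
qed

lemma linear_coefficient_U:
  "2 * pi * (2 * (\<Sum>j=1..p. real j * h (TT j)) + 2 * (real p + 1) * h TU - h TW + hx)
    + R * (c TU - c TV) = R * twist_W p TU"
proof -
  have "2 * pi * (\<Sum>j=1..p. real j * h (TT j)) = (\<Sum>j=1..p. real j * (2 * pi * h (TT j)))"
    by (simp add: sum_distrib_left mult_ac)
  also have "\<dots> = R * (\<Sum>j=1..p. real j * a (TT j)) - R * pi * (\<Sum>j=1..p. real j)"
    unfolding contour_heights by (simp add: sum_distrib_left algebra_simps sum_subtractf)
  also have "(\<Sum>j=1..p. real j) = real p * (real p + 1) / 2" by (induction p) (auto simp: field_simps)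
  finally have 1: "2 * pi * (\<Sum>j=1..p. real j * h (TT j))
    = R * (\<Sum>j=1..p. real j * a (TT j)) - R * pi * (real p * (real p + 1) / 2)" .
  have "2 * pi * (2 * (\<Sum>j=1..p. real j * h (TT j)) + 2 * (real p + 1) * h TU - h TW + hx) + R * (c TU - c TV)
    = 2 * (2 * pi * (\<Sum>j=1..p. real j * h (TT j))) + 2 * (real p + 1) * (2 * pi * h TU)
      - 2 * pi * h TW + 2 * pi * hx + R * (c TU - c TV)"
    by (simp add: algebra_simps)
  also have "\<dots> = R * (2 * (\<Sum>j=1..p. real j * a (TT j)) + 2 * (real p + 1) * a TU + a TW + a TU - a TV + c TU - c TV
     - pi * (real p * (real p + 1)) - 2 * (real p + 1) * pi - pi)"
    unfolding 1 contour_heights by (simp add: algebra_simps)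
  also have "\<dots> = R * twist_W p TU"
    unfolding angle_relation_U by (simp add: algebra_simps power2_eq_square)
  finally show ?thesis .
qed

lemma linear_coefficient_W: "2 * pi * (- h TU - hx) + R * c TW = R * pi"
proof -
  have "2 * pi * (- h TU - hx) + R * c TW = - (2 * pi * h TU) - 2 * pi * hx + R * c TW"
    by (simp add: algebra_simps)
  then show ?thesis unfolding contour_heights angle_relation_W by (simp add: algebra_simps)
qed

lemma linear_coefficient_x: "2 * pi * (h TU - h TW - 2 * hx) + R * c TV = R * (lam / 2 - pi)"
proof -
  have "2 * pi * (h TU - h TW - 2 * hx) + R * c TV = 2 * pi * h TU - 2 * pi * h TW - 2 * (2 * pi * hx) + R * c TV"
    by (simp add: algebra_simps)
  also have "\<dots> = R * (a TU - pi - pi + a TW - 2 * a TU + 2 * a TV + c TV)"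
    unfolding contour_heights by (simp add: algebra_simps)
  also have "a TU - pi - pi + a TW - 2 * a TU + 2 * a TV + c TV = lam / 2 - pi"
    using tet_angles(4)[of TV] by (simp add: lam_def field_simps)
  finally show ?thesis .
qed

lemma hx_eq_hU_plus_hV: "hx = h TU + hV"
proof -
  have "2 * pi * hx = 2 * pi * (h TU + hV)" unfolding distrib_left contour_heights by (simp add: algebra_simps)
  then show ?thesis by simp
qed

text \<open>
  The part of the exponent that is constant on the contours, divided by \<open>- \<i>\<close>; it is real, so it disappears in the modulus.
\<close>

definition phase where "phase =
  2 * pi * twist_form p (\<lambda>k. h (TT k)) (h TU) (h TW) hx
   + R * ((\<Sum>k=1..p. c (TT k) * h (TT k)) + c TU * h TU + c TV * hV + c TW * h TW)"

lemma exponent_shift: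
  fixes y :: "nat \<Rightarrow> complex" and yU yW x :: complex
  shows "2 * \<i> * complex_of_real pi * twist_form p (\<lambda>k. y k - \<i> * h (TT k)) (yU - \<i> * h TU) (yW - \<i> * h TW) (x - \<i> * hx)
     + R * ((\<Sum>k=1..p. c (TT k) * (y k - \<i> * h (TT k))) + c TU * (yU - \<i> * h TU)
       + c TV * (x - yU - \<i> * hV) + c TW * (yW - \<i> * h TW))
   = 2 * \<i> * complex_of_real pi * twist_form p y yU yW x
     + R * ((\<Sum>k=1..p. y k * twist_W p (TT k)) + yU * twist_W p TU + yW * twist_W p TW - pi * x)
     + R / 2 * x * lam - \<i> * phase"
proof -
  define Mk where "Mk k = (\<Sum>j=1..p. real (min j k) * h (TT j)) + real k * h TU" for k
  define MU where "MU = 2 * (\<Sum>j=1..p. real j * h (TT j)) + 2 * (real p + 1) * h TU - h TW + hx"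
  have form: "twist_form p (\<lambda>k. y k - \<i> * h (TT k)) (yU - \<i> * h TU) (yW - \<i> * h TW) (x - \<i> * hx)
    = twist_form p y yU yW x - \<i> * ((\<Sum>k=1..p. 2 * of_real (Mk k) * y k) + of_real MU * yU
        + of_real (- h TU - hx) * yW + of_real (h TU - h TW - 2 * hx) * x)
      - of_real (twist_form p (\<lambda>k. h (TT k)) (h TU) (h TW) hx)"
    using twist_form_shift[of p y "- \<i>" "\<lambda>k. of_real (h (TT k))" yU "of_real (h TU)" yW "of_real (h TW)" x "of_real hx"]
    by (simp add: of_real_twist_form Mk_def MU_def)
  have lin: "(\<Sum>k=1..p. c (TT k) * (y k - \<i> * h (TT k)))
      = (\<Sum>k=1..p. c (TT k) * y k) - \<i> * of_real (\<Sum>k=1..p. c (TT k) * h (TT k))"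
    by (simp add: algebra_simps sum_subtractf sum_distrib_left)
  have T: "2 * pi * (\<Sum>k=1..p. 2 * of_real (Mk k) * y k) + R * (\<Sum>k=1..p. c (TT k) * y k)
     = R * (\<Sum>k=1..p. y k * twist_W p (TT k))"
  proof -
    have "2 * pi * (\<Sum>k=1..p. 2 * of_real (Mk k) * y k) + R * (\<Sum>k=1..p. c (TT k) * y k)
      = (\<Sum>k=1..p. of_real (2 * pi * (2 * Mk k) + R * c (TT k)) * y k)"
      by (simp add: sum_distrib_left sum.distrib algebra_simps)
    also have "\<dots> = (\<Sum>k=1..p. of_real (R * twist_W p (TT k)) * y k)"
      by (intro sum.cong refl) (simp only: linear_coefficient_T Mk_def)
    finally show ?thesis by (simp add: sum_distrib_left mult_ac del: twist_W.simps)
  qed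
  have U: "2 * pi * (of_real MU * yU) + R * (c TU * yU - c TV * yU) = R * (yU * twist_W p TU)"
    using arg_cong[OF linear_coefficient_U[folded MU_def], of "\<lambda>z. complex_of_real z * yU"]
    by (simp add: algebra_simps del: twist_W.simps)
  have W: "2 * pi * (of_real (- h TU - hx) * yW) + R * (c TW * yW) = R * (yW * twist_W p TW)"
    using arg_cong[OF linear_coefficient_W, of "\<lambda>z. complex_of_real z * yW"] by (simp add: algebra_simps)
  have X: "2 * pi * (of_real (h TU - h TW - 2 * hx) * x) + R * (c TV * x) = R / 2 * x * lam - R * (pi * x)"
    using arg_cong[OF linear_coefficient_x, of "\<lambda>z. complex_of_real z * x"] by (simp add: algebra_simps)
  define L1 L2 L3 L4 S1 S2 where "L1 = (\<Sum>k=1..p. 2 * of_real (Mk k) * y k)" and "L2 = of_real MU * yU"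
    and "L3 = of_real (- h TU - hx) * yW" and "L4 = of_real (h TU - h TW - 2 * hx) * x"
    and "S1 = (\<Sum>k=1..p. c (TT k) * y k)" and "S2 = (\<Sum>k=1..p. c (TT k) * h (TT k))"
  have "2 * \<i> * complex_of_real pi * twist_form p (\<lambda>k. y k - \<i> * h (TT k)) (yU - \<i> * h TU) (yW - \<i> * h TW) (x - \<i> * hx)
     + R * ((\<Sum>k=1..p. c (TT k) * (y k - \<i> * h (TT k))) + c TU * (yU - \<i> * h TU)
       + c TV * (x - yU - \<i> * hV) + c TW * (yW - \<i> * h TW))
    = 2 * \<i> * complex_of_real pi * twist_form p y yU yW x
     + (2 * pi * L1 + R * S1) + (2 * pi * L2 + R * (c TU * yU - c TV * yU))
     + (2 * pi * L3 + R * (c TW * yW)) + (2 * pi * L4 + R * (c TV * x)) - \<i> * phase"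
    unfolding form lin L1_def[symmetric] L2_def[symmetric] L3_def[symmetric] L4_def[symmetric]
      S1_def[symmetric] S2_def[symmetric] phase_def
    by (simp add: algebra_simps)
  also have "\<dots> = 2 * \<i> * complex_of_real pi * twist_form p y yU yW x
     + R * (\<Sum>k=1..p. y k * twist_W p (TT k)) + R * (yU * twist_W p TU)
     + R * (yW * twist_W p TW) + (R / 2 * x * lam - R * (pi * x)) - \<i> * phase"
    using T U W X by (simp only: L1_def L2_def L3_def L4_def S1_def mult.assoc)
  finally show ?thesis by (simp add: algebra_simps del: twist_W.simps)
qed

section \<open>Matching the integrals\<close>

lemma dynamical_content_twist:
  assumes t: "t = s(TV := u - s TU)"
    and x: "x = complex_of_real u + \<i> * complex_of_real hx"
    and y: "y = (\<lambda>S. complex_of_real (s S) + \<i> * complex_of_real (h S))"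
  shows "dynamical_content \<b> (twist_triangulation n) (a, b, c) t
    = exp (complex_of_real R * complex_of_real ((\<Sum>k=1..p. c (TT k) * t (TT k)) + c TU * t TU + c TV * t TV + c TW * t TW))
      * (qdilog \<b> (x - y TU) * qdilog \<b> (y TW) / ((\<Prod>k=1..p. qdilog \<b> (y (TT k))) * qdilog \<b> (y TU)))"
proof -
  let ?z = "\<lambda>S. complex_of_real (t S) -
          \<i> * complex_of_real (of_int (twist_sign S) * (pi - a S) / (2 * pi * sqrt (hbar \<b>)))"
  have z: "?z (TT k) = y (TT k)" "?z TU = y TU" "?z TW = y TW" for k
    by (simp_all add: t y h_def twist_height_simps) (simp_all add: diff_divide_distrib right_diff_distrib)
  have "?z TV = complex_of_real (u - s TU) + \<i> * complex_of_real hV"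
    by (simp add: t hV_def R_def) (simp add: diff_divide_distrib right_diff_distrib mult_ac)
  also have "\<dots> = x - y TU"
    by (simp add: x y hx_eq_hU_plus_hV algebra_simps)
  finally have zV: "?z TV = x - y TU" .
  have sgn: "tet_sign (twist_triangulation n) = twist_sign" by (simp add: twist_triangulation_def Let_def)
  have "dynamical_content \<b> (twist_triangulation n) (a, b, c) t
    = (\<Prod>S\<in>TT ` {1..p} \<union> {TU, TV, TW}. exp (complex_of_real R * complex_of_real (c S * t S)) / qdilog \<b> (?z S) powi twist_sign S)"
    unfolding dynamical_content.simps sgn twist_tets(1) by (simp add: R_def)
  also have "\<dots> = (\<Prod>S\<in>TT ` {1..p} \<union> {TU, TV, TW}. exp (complex_of_real R * complex_of_real (c S * t S)))
     / (\<Prod>S\<in>TT ` {1..p} \<union> {TU, TV, TW}. qdilog \<b> (?z S) powi twist_sign S)"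
    by (rule prod_dividef)
  also have "(\<Prod>S\<in>TT ` {1..p} \<union> {TU, TV, TW}. exp (complex_of_real R * complex_of_real (c S * t S)))
    = exp (complex_of_real R * complex_of_real ((\<Sum>k=1..p. c (TT k) * t (TT k)) + c TU * t TU + c TV * t TV + c TW * t TW))"
    unfolding prod_twist_tets by (simp add: exp_sum[symmetric] exp_add[symmetric] sum_distrib_left distrib_left)
  also have "(\<Prod>S\<in>TT ` {1..p} \<union> {TU, TV, TW}. qdilog \<b> (?z S) powi twist_sign S)
    = (\<Prod>k=1..p. qdilog \<b> (y (TT k))) * qdilog \<b> (y TU) * inverse (qdilog \<b> (x - y TU)) * inverse (qdilog \<b> (y TW))"
    unfolding prod_twist_tets z zV by (simp add: power_int_minus)
  also have "e / (q * r * inverse q' * inverse r') = e * (q' * r' / (q * r))" for e q r q' r' :: complex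
    by (simp add: divide_inverse)
  finally show ?thesis .
qed

lemma integrand_identity:
  assumes t: "t = s(TV := u - s TU)"
    and x: "x = complex_of_real u + \<i> * complex_of_real hx"
    and y: "y = (\<lambda>S. complex_of_real (s S) + \<i> * complex_of_real (h S))"
  shows "twist_J_integrand \<b> p x y * exp (complex_of_real (1 / (2 * sqrt (hbar \<b>))) * x * complex_of_real lam)
    = exp (\<i> * complex_of_real (phase)) *
      (kinematical_kernel (twist_triangulation n) t * dynamical_content \<b> (twist_triangulation n) (a, b, c) t)"
proof -
  define \<Psi> where "\<Psi> = qdilog \<b> (x - y TU) * qdilog \<b> (y TW) / ((\<Prod>k=1..p. qdilog \<b> (y (TT k))) * qdilog \<b> (y TU))"
  define F where "F = twist_form p (\<lambda>k. y (TT k)) (y TU) (y TW) x"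
  define L where "L = (\<Sum>k=1..p. y (TT k) * twist_W p (TT k)) + y TU * twist_W p TU + y TW * twist_W p TW - pi * x"
  have "twist_J_integrand \<b> p x y * exp (complex_of_real (1 / (2 * sqrt (hbar \<b>))) * x * complex_of_real lam)
      = exp (2 * \<i> * complex_of_real pi * F + R * L + R / 2 * x * lam) * \<Psi>"
  proof -
    have "F = (\<Sum>j\<in>twist_index p. \<Sum>k\<in>twist_index p. y j * complex_of_real (twist_Q p j k) * y k) + x * (y TU - y TW - x)"
      unfolding F_def by (rule twist_form_Q[symmetric])
    moreover have "L = (\<Sum>k\<in>twist_index p. y k * complex_of_real (twist_W p k)) - complex_of_real pi * x"
      unfolding L_def sum_twist_index ..
    moreover have half: "1 / (2 * sqrt (hbar \<b>)) = R / 2" by (simp add: R_def)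
    ultimately show ?thesis
      unfolding twist_J_integrand_def \<Psi>_def half R_def[symmetric]
      by (simp add: exp_add distrib_left mult.assoc)
  qed
  moreover have "kinematical_kernel (twist_triangulation n) t * dynamical_content \<b> (twist_triangulation n) (a, b, c) t
     = exp (2 * \<i> * complex_of_real pi * F + R * L + R / 2 * x * lam - \<i> * phase) * \<Psi>"
  proof -
    have ty: "complex_of_real (t (TT k)) = y (TT k) - \<i> * h (TT k)" "complex_of_real (t TU) = y TU - \<i> * h TU"
      "complex_of_real (t TW) = y TW - \<i> * h TW" "complex_of_real (t TU + t TV) = x - \<i> * hx"
      "complex_of_real (t TV) = x - y TU - \<i> * hV" for k
      using hx_eq_hU_plus_hV by (simp_all add: t x y algebra_simps)
    have "2 * \<i> * complex_of_real pi * complex_of_real (twist_form p (\<lambda>k. t (TT k)) (t TU) (t TW) (t TU + t TV))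
      + complex_of_real R * complex_of_real ((\<Sum>k=1..p. c (TT k) * t (TT k)) + c TU * t TU + c TV * t TV + c TW * t TW)
      = 2 * \<i> * complex_of_real pi * F + R * L + R / 2 * x * lam - \<i> * phase"
      unfolding F_def L_def exponent_shift[symmetric]
      unfolding of_real_twist_form of_real_sum[of _ "{1..p}"] of_real_add[of "_ + _"] of_real_add[of "sum _ _"] of_real_mult ty ..
    then show ?thesis
      unfolding kinematical_kernel_twist dynamical_content_twist[OF t x y] \<Psi>_def[symmetric]
        mult.assoc[symmetric] exp_add[symmetric] by simp
  qed
  moreover have "exp (\<i> * complex_of_real \<theta>) * (exp (E - \<i> * complex_of_real \<theta>) * \<Psi>) = exp E * \<Psi>" for \<theta> E
    by (simp add: exp_diff)
  ultimately show ?thesis by (simp only:)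
qed

definition tet_factor :: "twist_tet \<Rightarrow> real \<Rightarrow> complex" where
  "tet_factor S t = exp (complex_of_real (c S * t / sqrt (hbar \<b>))) /
       qdilog \<b> (complex_of_real t -
          \<i> * complex_of_real (of_int (twist_sign S) * (pi - a S) / (2 * pi * sqrt (hbar \<b>)))) powi twist_sign S"

text \<open>
  The kernel has modulus one, so the integrand of the partition function is dominated by a product of
  integrable functions of the single variables, one for each tetrahedron.
\<close>

lemma partition_function_eq:
  "partition_function \<b> (twist_triangulation n) (a, b, c)
    = (LINT u|lborel. LINT s|Pi\<^sub>M (twist_index p) (\<lambda>_. lborel).
        kinematical_kernel (twist_triangulation n) (s(TV := u - s TU)) *
        dynamical_content \<b> (twist_triangulation n) (a, b, c) (s(TV := u - s TU)))"
proof -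
  have ins: "TT ` {1..p} \<union> {TU, TV, TW} = insert TV (twist_index p)" by (auto simp: twist_index_def)
  have D: "dynamical_content \<b> (twist_triangulation n) (a, b, c) t = (\<Prod>S\<in>insert TV (twist_index p). tet_factor S (t S))" for t
    unfolding dynamical_content.simps twist_tets(1) ins tet_factor_def
    by (simp add: twist_triangulation_def Let_def)
  have int: "integrable lborel (tet_factor S)" if "S \<in> insert TV (twist_index p)" for S
    unfolding tet_factor_def
    by (rule integrable_tetrahedron_factor[OF b_pos tet_angles[OF that[folded ins]]]) (cases S; simp)
  have fin: "finite (twist_index p)" "TV \<notin> twist_index p" "TU \<in> twist_index p"
    by (auto simp: twist_index_def)
  interpret P: product_sigma_finite "\<lambda>_::twist_tet. lborel :: real measure" ..
  let ?M = "Pi\<^sub>M (insert TV (twist_index p)) (\<lambda>_. lborel :: real measure)"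
  show ?thesis
    unfolding partition_function_def twist_tets(1) ins
  proof (rule integral_shear[OF fin, where g = "\<lambda>S t. cmod (tet_factor S t)"])
    have [measurable]: "(\<lambda>t. dynamical_content \<b> (twist_triangulation n) (a, b, c) t) \<in> borel_measurable ?M"
      unfolding D by (intro borel_measurable_integrable P.product_integrable_prod) (use fin int in auto)
    have comp[measurable]: "(\<lambda>t. t S) \<in> borel_measurable ?M" if "S \<in> insert TV (twist_index p)" for S
      using measurable_component_singleton[OF that, of "\<lambda>_. lborel"] by simp
    have [measurable]: "(\<lambda>t. t TU) \<in> borel_measurable ?M" "(\<lambda>t. t TV) \<in> borel_measurable ?M" "(\<lambda>t. t TW) \<in> borel_measurable ?M"
      by (intro comp; simp add: twist_index_def)+
    have [measurable]: "(\<lambda>t. twist_form p (\<lambda>k. t (TT k)) (t TU) (t TW) (t TU + t TV)) \<in> borel_measurable ?M"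
      unfolding twist_form_def
      by (intro borel_measurable_add borel_measurable_diff borel_measurable_times borel_measurable_sum
          borel_measurable_const comp) (auto simp: twist_index_def)
    show "(\<lambda>t. kinematical_kernel (twist_triangulation n) t * dynamical_content \<b> (twist_triangulation n) (a, b, c) t)
      \<in> borel_measurable ?M"
      unfolding kinematical_kernel_twist by measurable
    show "cmod (kinematical_kernel (twist_triangulation n) t * dynamical_content \<b> (twist_triangulation n) (a, b, c) t)
      \<le> (\<Prod>S\<in>insert TV (twist_index p). cmod (tet_factor S (t S)))" for t
      unfolding kinematical_kernel_twist D norm_mult prod_norm
      by (simp add: norm_exp_eq_Re)
  qed (use int in auto)
qed

lemma twist_J_integral_eq:
  "twist_J \<b> p a (complex_of_real u + \<i> * complex_of_real hx) *
     exp (complex_of_real (1 / (2 * sqrt (hbar \<b>))) * (complex_of_real u + \<i> * complex_of_real hx) * complex_of_real lam)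
   = exp (\<i> * complex_of_real (phase)) *
     (LINT s|Pi\<^sub>M (twist_index p) (\<lambda>_. lborel).
        kinematical_kernel (twist_triangulation n) (s(TV := u - s TU)) *
        dynamical_content \<b> (twist_triangulation n) (a, b, c) (s(TV := u - s TU)))"
  unfolding twist_J_def h_def[symmetric] integral_mult_left_zero[symmetric] integral_mult_right_zero[symmetric]
  by (intro Bochner_Integration.integral_cong refl integrand_identity[OF refl refl refl])

end

theorem theorem8p4:
  fixes n p :: nat and \<b> mu lam :: real and a b c :: "twist_tet \<Rightarrow> real"
  assumes "n > 0" and "even n" and "p = (n - 2) div 2"
    and "\<b> > 0"
    and "(a, b, c) \<in> angle_structures (twist_triangulation n)"
    and "mu = a TU - a TV"
    and "lam = 2 * (a TV - a TU + a TW - b TV)"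
  shows "cmod (partition_function \<b> (twist_triangulation n) (a, b, c)) =
    cmod (line_integral (mu / (2 * pi * sqrt (hbar \<b>)))
      (\<lambda>x. twist_J \<b> p a x * exp (complex_of_real (1 / (2 * sqrt (hbar \<b>))) * x * complex_of_real lam)))"
proof -
  interpret X: twist_partition_function n p a b c \<b>
    by unfold_locales (fact assms)+
  have mu: "mu / (2 * pi * sqrt (hbar \<b>)) = X.hx" and lam: "lam = X.lam"
    by (simp_all add: assms(6,7) X.hx_def X.R_def X.mu_def X.lam_def)
  have "line_integral X.hx (\<lambda>x. twist_J \<b> p a x *
      exp (complex_of_real (1 / (2 * sqrt (hbar \<b>))) * x * complex_of_real X.lam))
    = exp (\<i> * complex_of_real X.phase) * partition_function \<b> (twist_triangulation n) (a, b, c)"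
    unfolding line_integral_def X.twist_J_integral_eq X.partition_function_eq integral_mult_right_zero ..
  then show ?thesis unfolding mu lam by (simp add: norm_mult)
qed

end
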